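(* Let $K$ be a field. The minimal number of vertices in the support of an indecomposable 2D persistence module (over $K$) whose support has a hole is equal to $11$. For example, the following 2D persistence module $M$ realizes this minimum (that is, it is indecomposable, its support has a hole, and its support has exactly $11$ vertices). Writing points of $\mathbb{Z}\times\mathbb{Z}$ as (row, column), $M$ has $M(1,2)=K^2$; $M(p)=K$ for $p\in\{(0,2),(0,3),(1,0),(1,1),(1,3),(2,0),(2,2),(3,0),(3,1),(3,2)\}$; and $M(p)=0$ for all other $p$ (in particular $M(2,1)=0$). Its maps between adjacent points of its support are: $M((1,1)\le(1,2))=\begin{bmatrix}1\\0\end{bmatrix}$, $M((0,2)\le(1,2))=\begin{bmatrix}1\\1\end{bmatrix}$, $M((1,2)\le(1,3))=\begin{bmatrix}1&0\end{bmatrix}$, $M((1,2)\le(2,2))=\begin{bmatrix}0&1\end{bmatrix}$, $M((2,0)\le(3,0))=0$, and the identity of $K$ for the remaining ones: $(1,0)\le(1,1)$, $(0,2)\le(0,3)$, $(0,3)\le(1,3)$, $(1,0)\le(2,0)$, $(2,2)\le(3,2)$, $(3,0)\le(3,1)$, $(3,1)\le(3,2)$.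
   Context: $\mathrm{vect}_K$ is the category of finite-dimensional $K$-vector spaces. $\mathbb{Z}\times\mathbb{Z}$ carries the product order: $(a,b)\le(x,y)$ iff $a\le x$ and $b\le y$. A 2D persistence module is a functor $M:(\mathbb{Z}\times\mathbb{Z},\le)\to\mathrm{vect}_K$; it is determined by its spaces and its maps between adjacent grid points, subject to commutativity of all unit squares. Direct sums are taken pointwise. $M$ is indecomposable if $M\ne0$ and $M\cong W\oplus W'$ implies $W=0$ or $W'=0$. Its support is $\mathrm{supp}(M)=\{x: M(x)\neq0\}$. The clique cubical complex of $\mathrm{supp}(M)$ is the cubical complex whose vertices are the points of $\mathrm{supp}(M)$, with an edge between any two points of $\mathrm{supp}(M)$ that are adjacent on the grid $\mathbb{Z}^2$ (differ by $1$ in exactly one coordinate), and with a unit square for each $(i,j)$ such that $(i,j),(i,j+1),(i+1,j+1),(i+1,j)\in\mathrm{supp}(M)$. The support of $M$ has a hole if the $1$-dimensional homology (with coefficients in $K$) of this complex is nonzero. *)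

theory Defs
  imports
    "HOL-Analysis.Product_Vector"
    "HOL-Library.Product_Order"
    "HOL-Library.Poly_Mapping"
begin

section \<open>Persistence modules over the poset of integer pairs\<close>

text \<open>
  The order on \<open>int \<times> int\<close> is the componentwise one of \<open>Product_Order\<close>.  The finite-dimensional
  vector space at a point \<open>p\<close> is a subspace \<open>sp M p\<close> of one ambient vector space, which is the
  whole type \<open>'v\<close> with scalar multiplication \<open>scl M\<close>.  This loses no generality: the spaces of
  any functor embed into their direct sum.  Structure maps are relevant only as \<open>tr M p q\<close> with
  \<open>p \<le> q\<close>, and only on \<open>sp M p\<close>.
\<close>

type_synonym point = "int \<times> int"

record ('k, 'v) pmodule =
  scl :: "'k \<Rightarrow> 'v \<Rightarrow> 'v"
  sp :: "point \<Rightarrow> 'v set"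
  tr :: "point \<Rightarrow> point \<Rightarrow> 'v \<Rightarrow> 'v"

definition fin_dim_subspace :: "('k::field \<Rightarrow> 'v::ab_group_add \<Rightarrow> 'v) \<Rightarrow> 'v set \<Rightarrow> bool" where
  "fin_dim_subspace s V \<longleftrightarrow> module.subspace s V \<and> (\<exists>B. finite B \<and> module.span s B = V)"

definition linear_between ::
  "('k \<Rightarrow> 'v::ab_group_add \<Rightarrow> 'v) \<Rightarrow> ('k \<Rightarrow> 'w::ab_group_add \<Rightarrow> 'w)
    \<Rightarrow> 'v set \<Rightarrow> 'w set \<Rightarrow> ('v \<Rightarrow> 'w) \<Rightarrow> bool" where
  "linear_between s t V W f \<longleftrightarrow>
     (\<forall>x\<in>V. f x \<in> W) \<and>
     (\<forall>x\<in>V. \<forall>y\<in>V. f (x + y) = f x + f y) \<and>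
     (\<forall>c. \<forall>x\<in>V. f (s c x) = t c (f x))"

definition persistence_module :: "('k::field, 'v::ab_group_add) pmodule \<Rightarrow> bool" where
  "persistence_module M \<longleftrightarrow>
     vector_space (scl M) \<and>
     (\<forall>p. fin_dim_subspace (scl M) (sp M p)) \<and>
     (\<forall>p q. p \<le> q \<longrightarrow> linear_between (scl M) (scl M) (sp M p) (sp M q) (tr M p q)) \<and>
     (\<forall>p. \<forall>x\<in>sp M p. tr M p p x = x) \<and>
     (\<forall>p q r. p \<le> q \<longrightarrow> q \<le> r \<longrightarrow> (\<forall>x\<in>sp M p. tr M q r (tr M p q x) = tr M p r x))"

definition supp :: "('k, 'v::zero) pmodule \<Rightarrow> point set" where
  "supp M = {p. sp M p \<noteq> {0}}"

definition zero_module :: "('k, 'v::zero) pmodule \<Rightarrow> bool" where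
  "zero_module M \<longleftrightarrow> (\<forall>p. sp M p = {0})"

definition direct_sum ::
  "('k::field, 'v::ab_group_add) pmodule \<Rightarrow> ('k, 'w::ab_group_add) pmodule
    \<Rightarrow> ('k, 'v \<times> 'w) pmodule" where
  "direct_sum M N =
     \<lparr> scl = module_prod.scale (scl M) (scl N),
       sp = (\<lambda>p. sp M p \<times> sp N p),
       tr = (\<lambda>p q. map_prod (tr M p q) (tr N p q)) \<rparr>"

definition isomorphic ::
  "('k::field, 'v::ab_group_add) pmodule \<Rightarrow> ('k, 'w::ab_group_add) pmodule \<Rightarrow> bool" where
  "isomorphic M N \<longleftrightarrow>
     (\<exists>\<phi>. (\<forall>p. linear_between (scl M) (scl N) (sp M p) (sp N p) (\<phi> p) \<and>
               bij_betw (\<phi> p) (sp M p) (sp N p)) \<and>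
          (\<forall>p q. p \<le> q \<longrightarrow> (\<forall>x\<in>sp M p. \<phi> q (tr M p q x) = tr N p q (\<phi> p x))))"

text \<open>
  The summands \<open>W\<close> and \<open>W'\<close> range over modules with the same ambient type as \<open>M\<close>.  This covers
  all summands up to isomorphism, since a summand of \<open>M\<close> embeds into \<open>M\<close>.
\<close>

definition indecomposable :: "('k::field, 'v::ab_group_add) pmodule \<Rightarrow> bool" where
  "indecomposable M \<longleftrightarrow>
     persistence_module M \<and> \<not> zero_module M \<and>
     (\<forall>(W :: ('k, 'v) pmodule) (W' :: ('k, 'v) pmodule).
        persistence_module W \<and> persistence_module W' \<and> isomorphic M (direct_sum W W')
          \<longrightarrow> zero_module W \<or> zero_module W')"


section \<open>The clique cubical complex and its first homology\<close>

text \<open>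
  The vertices are the points of \<open>S\<close>.  An edge is the pair of its endpoints, lower one first; a
  unit square is represented by its least corner.  Chains are finitely supported functions.
\<close>

definition cc_edges :: "point set \<Rightarrow> (point \<times> point) set" where
  "cc_edges S = {(p, q). p \<in> S \<and> q \<in> S \<and> (q = p + (1, 0) \<or> q = p + (0, 1))}"

definition cc_squares :: "point set \<Rightarrow> point set" where
  "cc_squares S = {(i, j). (i, j) \<in> S \<and> (i, j + 1) \<in> S \<and> (i + 1, j + 1) \<in> S \<and> (i + 1, j) \<in> S}"

definition boundary1 :: "((point \<times> point) \<Rightarrow>\<^sub>0 'k::field) \<Rightarrow> (point \<Rightarrow>\<^sub>0 'k)" where
  "boundary1 c =
     (\<Sum>(p, q)\<in>Poly_Mapping.keys c.
        Poly_Mapping.single q (Poly_Mapping.lookup c (p, q))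
        - Poly_Mapping.single p (Poly_Mapping.lookup c (p, q)))"

definition boundary2 :: "(point \<Rightarrow>\<^sub>0 'k::field) \<Rightarrow> ((point \<times> point) \<Rightarrow>\<^sub>0 'k)" where
  "boundary2 c =
     (\<Sum>p\<in>Poly_Mapping.keys c.
        Poly_Mapping.single (p, p + (1, 0)) (Poly_Mapping.lookup c p)
        + Poly_Mapping.single (p + (1, 0), p + (1, 1)) (Poly_Mapping.lookup c p)
        - Poly_Mapping.single (p + (0, 1), p + (1, 1)) (Poly_Mapping.lookup c p)
        - Poly_Mapping.single (p, p + (0, 1)) (Poly_Mapping.lookup c p))"

definition cycles1 :: "point set \<Rightarrow> ((point \<times> point) \<Rightarrow>\<^sub>0 'k::field) set" where
  "cycles1 S = {z. Poly_Mapping.keys z \<subseteq> cc_edges S \<and> boundary1 z = 0}"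

definition boundaries1 :: "point set \<Rightarrow> ((point \<times> point) \<Rightarrow>\<^sub>0 'k::field) set" where
  "boundaries1 S = boundary2 ` {c. Poly_Mapping.keys c \<subseteq> cc_squares S}"

definition homology1 :: "point set \<Rightarrow> ((point \<times> point) \<Rightarrow>\<^sub>0 'k::field) set set" where
  "homology1 S =
     cycles1 S // {(z, z'). z \<in> cycles1 S \<and> z' \<in> cycles1 S \<and> z - z' \<in> boundaries1 S}"

text \<open>\<open>boundaries1 S\<close> is the zero element of the quotient \<open>homology1 S\<close>.\<close>

definition support_has_hole :: "('k::field, 'v::zero) pmodule \<Rightarrow> bool" where
  "support_has_hole M \<longleftrightarrow>
     (homology1 (supp M) :: ((point \<times> point) \<Rightarrow>\<^sub>0 'k) set set) \<noteq> {boundaries1 (supp M)}"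


section \<open>The example\<close>

text \<open>
  Inside the ambient space \<open>K\<^sup>2 = 'k \<times> 'k\<close>, the space \<open>K\<close> is the first coordinate axis, so the
  vector \<open>x\<close> of \<open>K\<close> is \<open>(x, 0)\<close>.  Spaces and adjacent maps determine the module on all of its
  spaces; maps out of or into a zero space need not be listed.
\<close>

definition example_module :: "('k::field, 'k \<times> 'k) pmodule \<Rightarrow> bool" where
  "example_module M \<longleftrightarrow>
     persistence_module M \<and>
     scl M = module_prod.scale (*) (*) \<and>
     (let L = {(0,2), (0,3), (1,0), (1,1), (1,3), (2,0), (2,2), (3,0), (3,1), (3,2)} in
        sp M (1,2) = UNIV \<and>
        (\<forall>p\<in>L. sp M p = UNIV \<times> {0}) \<and>
        (\<forall>p. p \<notin> insert (1,2) L \<longrightarrow> sp M p = {0})) \<and>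
     (\<forall>x. tr M (1,1) (1,2) (x, 0) = (x, 0)) \<and>
     (\<forall>x. tr M (0,2) (1,2) (x, 0) = (x, x)) \<and>
     (\<forall>x y. tr M (1,2) (1,3) (x, y) = (x, 0)) \<and>
     (\<forall>x y. tr M (1,2) (2,2) (x, y) = (y, 0)) \<and>
     (\<forall>x. tr M (2,0) (3,0) (x, 0) = (0, 0)) \<and>
     (\<forall>(p, q)\<in>{((1,0),(1,1)), ((0,2),(0,3)), ((0,3),(1,3)), ((1,0),(2,0)),
                ((2,2),(3,2)), ((3,0),(3,1)), ((3,1),(3,2))}.
        \<forall>x. tr M p q (x, 0) = (x, 0))"

end

theory Submission
  imports Defs
begin

text \<open>
  A cycle of the support \<open>S\<close> that is not a boundary has a nonzero winding number around some missing
  point \<open>v\<close>, and the set \<open>T\<close> of missing points with nonzero winding number is finite with all its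
  king-move neighbours in \<open>T \<union> S\<close>.  Extremal points of \<open>T\<close> in the four closed quadrants at \<open>v\<close> show
  that \<open>S\<close> has at least three points below \<open>v\<close>, three points above \<open>v\<close>, and one point in each of the
  two open quadrants incomparable to \<open>v\<close>.  If \<open>S\<close> has at most 10 points, each open incomparable quadrant
  has thus at most three of them, so it contains no four corners of a rectangle, and all
  maps inside it that increase both coordinates vanish.

  Under this condition, the endomorphism that is the identity below \<open>v\<close> and zero above \<open>v\<close> extends to
  the incomparable quadrants; it is natural across \<open>v\<close> because every map from below to above factors
  through \<open>M v = 0\<close>.  By Fitting's lemma an indecomposable module has no such endomorphism.

  For the example, the three lines \<open>(x, 0)\<close>, \<open>(x, x)\<close>, \<open>(0, x)\<close> in \<open>K\<^sup>2\<close> force every endomorphism to be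
  a scalar.
\<close>

section \<open>Linear maps between subspaces\<close>

text \<open>Extending the endomorphism into an incomparable quadrant meets an obstruction. At each
  point it is forced on images of maps from below the hole and modulo kernels of maps to points
  above it, and it must preserve every kernel and image through which it is continued further. A
  chain of subspaces can be respected in this way, but unrelated subspaces need not be. In the
  example, with the hole at \<open>(2, 1)\<close>, its value at \<open>(1, 2)\<close> would be a
  projection onto the line \<open>(x, 0)\<close> that also preserves \<open>(x, x)\<close>, the
  image from \<open>(0, 2)\<close>, and \<open>(0, x)\<close>, the kernel towards
  \<open>(1, 3)\<close>; but only one of these two lines can be its kernel. The two are not nested
  because the map from \<open>(0, 2)\<close> to \<open>(1, 3)\<close> is nonzero, which takes a full
  unit square inside the quadrant. When such diagonal maps vanish, images lie in kernels, all the
  subspaces concerned form a chain, and the extension can be built member by member along it. So a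
  fourth point in one incomparable quadrant, and with it an eleventh point in total, is what an
  indecomposable module needs.\<close>

lemma linear_betweenD:
  assumes "linear_between s t V W f"
  shows "x \<in> V \<Longrightarrow> f x \<in> W"
    and "x \<in> V \<Longrightarrow> y \<in> V \<Longrightarrow> f (x + y) = f x + f y"
    and "x \<in> V \<Longrightarrow> f (s c x) = t c (f x)"
  using assms unfolding linear_between_def by blast+

lemma linear_between_compose:
  assumes "linear_between s t V W f" and "linear_between t u W X g"
  shows "linear_between s u V X (\<lambda>x. g (f x))"
  using assms unfolding linear_between_def by auto

lemma linear_between_funpow:
  assumes "linear_between s s V V e"
  shows "linear_between s s V V (e ^^ n)"
  using assms unfolding linear_between_def by (induction n) auto

lemma sorted_wrt_subset_last:
  assumes "sorted_wrt (\<subseteq>) L" and "D \<in> set L"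
  shows "D \<subseteq> last L"
  using assms by (induction L) auto

locale ambient_space = vector_space scale
  for scale :: "'k::field \<Rightarrow> 'v::ab_group_add \<Rightarrow> 'v" (infixr "*s" 75)
begin

abbreviation lin :: "'v set \<Rightarrow> 'v set \<Rightarrow> ('v \<Rightarrow> 'v) \<Rightarrow> bool" where
  "lin \<equiv> linear_between scale scale"

lemma lin_zero:
  assumes "subspace V" and "lin V W f"
  shows "f 0 = 0"
proof -
  have "f (0 + 0) = f 0 + f 0"
    using assms linear_betweenD(2) subspace_0 by blast
  then show ?thesis by simp
qed

lemma lin_diff:
  assumes "subspace V" and "lin V W f" and "x \<in> V" and "y \<in> V"
  shows "f (x - y) = f x - f y"
proof -
  have "f ((x - y) + y) = f (x - y) + f y"
    using assms linear_betweenD(2) subspace_diff by blast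
  then show ?thesis by simp
qed

lemma lin_subset:
  assumes "lin V W f" and "V' \<subseteq> V" and "W \<subseteq> W'"
  shows "lin V' W' f"
  using assms unfolding linear_between_def by blast

lemma lin_image_subspace:
  assumes "subspace V" and "lin V W f"
  shows "subspace (f ` V)"
proof (rule subspaceI)
  show "0 \<in> f ` V"
    using assms by (metis imageI lin_zero subspace_0)
next
  fix x y assume "x \<in> f ` V" "y \<in> f ` V"
  then obtain a b where "a \<in> V" "b \<in> V" "x = f a" "y = f b"
    by blast
  then show "x + y \<in> f ` V"
    using linear_betweenD(2)[OF assms(2), of a b] subspace_add[OF assms(1)] by (metis imageI)
next
  fix c x assume "x \<in> f ` V"
  then obtain a where "a \<in> V" "x = f a"
    by blast
  then show "c *s x \<in> f ` V"
    using linear_betweenD(3)[OF assms(2), of a c] subspace_scale[OF assms(1)] by (metis imageI)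
qed

lemma lin_vimage_subspace:
  assumes "subspace V" and "lin V W f" and "subspace U"
  shows "subspace {x \<in> V. f x \<in> U}"
  using assms
  by (auto intro!: subspaceI simp: subspace_0 lin_zero linear_betweenD subspace_add subspace_scale)

text \<open>Structure maps are linear only on their spaces and arbitrary elsewhere. Replacing them
  by maps linear on the whole type makes the theorems on spans and independent sets
  applicable.\<close>

lemma extend_to_linear:
  assumes V: "subspace V" and f: "lin V W f"
  obtains g where "Vector_Spaces.linear scale scale g" and "\<And>x. x \<in> V \<Longrightarrow> g x = f x"
proof -
  interpret p: vector_space_pair scale scale by unfold_locales
  obtain B where B: "B \<subseteq> V" "independent B" "V \<subseteq> span B"
    using maximal_independent_subset by blast
  obtain g where g: "Vector_Spaces.linear scale scale g" "\<forall>x\<in>B. g x = f x"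
    using p.linear_independent_extend[OF B(2)] by blast
  have "g x = f x" if "x \<in> V" for x
  proof -
    have "x \<in> span B"
      using that B by blast
    then have "x \<in> V \<and> g x = f x"
    proof (induction rule: span_induct_alt)
      case base
      show ?case
        using g lin_zero[OF V f] subspace_0[OF V] by (simp add: linear_iff_module_hom module_hom.zero)
    next
      case (step c x y)
      have x: "x \<in> V" "c *s x \<in> V" using B step subspace_scale[OF V] by blast+
      interpret g: Vector_Spaces.linear scale scale g by (fact g)
      show ?case
        using step g(2) x subspace_add[OF V] linear_betweenD(2)[OF f] linear_betweenD(3)[OF f]
        by (simp add: g.add g.scale)
    qed
    then show ?thesis ..
  qed
  with g that show thesis by blast
qed

text \<open>A basis of \<open>V0\<close> is completed to one of \<open>V\<close>: old basis vectors
  keep their values under \<open>g0\<close>, and each new one goes to some preimage under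
  \<open>f\<close> of its value under \<open>h\<close>.\<close>

lemma lift_extend:
  assumes V: "subspace V" and V0: "subspace V0" "V0 \<subseteq> V" and A: "subspace A"
    and g0: "lin V0 A g0" and f: "lin A B f" and h: "lin V B h"
    and comm: "\<And>x. x \<in> V0 \<Longrightarrow> f (g0 x) = h x"
    and onto: "\<And>x. x \<in> V \<Longrightarrow> h x \<in> f ` A"
  obtains g where "lin V A g" and "\<And>x. x \<in> V0 \<Longrightarrow> g x = g0 x" and "\<And>x. x \<in> V \<Longrightarrow> f (g x) = h x"
proof -
  interpret p: vector_space_pair scale scale by unfold_locales
  obtain B0 where B0: "B0 \<subseteq> V0" "independent B0" "V0 \<subseteq> span B0"
    using maximal_independent_subset by blast
  obtain C where C: "B0 \<subseteq> C" "C \<subseteq> V" "independent C" "V \<subseteq> span C"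
    using maximal_independent_subset_extend[of B0 V] B0 V0 by blast
  define k where "k b = (if b \<in> B0 then g0 b else SOME a. a \<in> A \<and> f a = h b)" for b
  have k: "k b \<in> A \<and> f (k b) = h b" if "b \<in> C" for b
  proof (cases "b \<in> B0")
    case True
    then show ?thesis
      using B0 comm linear_betweenD(1)[OF g0] by (auto simp: k_def)
  next
    case False
    have "\<exists>a. a \<in> A \<and> f a = h b"
      using onto[of b] C that by force
    then show ?thesis
      using False by (metis (mono_tags, lifting) k_def someI_ex)
  qed
  obtain g where g: "Vector_Spaces.linear scale scale g" "\<forall>x\<in>C. g x = k x"
    using p.linear_independent_extend[OF C(3)] by blast
  interpret g: Vector_Spaces.linear scale scale g by (fact g)
  have gA: "g x \<in> A \<and> x \<in> V \<and> f (g x) = h x" if "x \<in> V" for x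
  proof -
    have "x \<in> span C"
      using that C by blast
    then show ?thesis
    proof (induction rule: span_induct_alt)
      case base
      show ?case
        using A V f h by (simp add: g.zero subspace_0 lin_zero)
    next
      case (step c x y)
      have x: "x \<in> V" "g x \<in> A" "f (g x) = h x"
        using C step k g by auto
      have cx: "c *s x \<in> V" "c *s g x \<in> A"
        using x A V subspace_scale by auto
      show ?case
        using step x cx A V
        by (auto simp: g.add g.scale subspace_add linear_betweenD(2)[OF f] linear_betweenD(2)[OF h]
            linear_betweenD(3)[OF f] linear_betweenD(3)[OF h])
    qed
  qed
  have "g x = g0 x" if "x \<in> V0" for x
  proof -
    obtain g' where g': "Vector_Spaces.linear scale scale g'" "\<And>x. x \<in> V0 \<Longrightarrow> g' x = g0 x"
      using extend_to_linear[OF V0(1) g0] by blast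
    have "g x = g' x"
      by (rule p.linear_eq_on[OF g(1) g'(1), of _ B0]) (use that B0 C g g' in \<open>auto simp: k_def subset_iff\<close>)
    with g' that show ?thesis by simp
  qed
  moreover have "lin V A g"
    using gA by (auto simp: linear_between_def g.add g.scale)
  ultimately show thesis
    using gA that by blast
qed

text \<open>Two decompositions of one vector differ by an element common to \<open>U\<close> and
  \<open>V\<close>, where \<open>f\<close> and \<open>g\<close> agree; so \<open>f x + g y\<close>
  depends only on \<open>x + y\<close>.\<close>

lemma glue:
  assumes U: "subspace U" and V: "subspace V" and f: "lin U W f" and g: "lin V W g"
    and W: "subspace W"
    and eq: "\<And>x. x \<in> U \<Longrightarrow> x \<in> V \<Longrightarrow> f x = g x"
  obtains h where "lin {x + y | x y. x \<in> U \<and> y \<in> V} W h"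
    and "\<And>x. x \<in> U \<Longrightarrow> h x = f x" and "\<And>x. x \<in> V \<Longrightarrow> h x = g x"
proof -
  define h where "h z = (SOME w. \<exists>x y. x \<in> U \<and> y \<in> V \<and> z = x + y \<and> w = f x + g y)" for z
  have h: "h (x + y) = f x + g y" if "x \<in> U" "y \<in> V" for x y
  proof -
    have "\<exists>x' y'. x' \<in> U \<and> y' \<in> V \<and> x + y = x' + y' \<and> h (x + y) = f x' + g y'"
      unfolding h_def by (rule someI_ex) (use that in blast)
    then obtain x' y' where xy: "x' \<in> U" "y' \<in> V" "x + y = x' + y'" "h (x + y) = f x' + g y'"
      by blast
    have d: "x - x' = y' - y"
      using xy(3) by (simp add: algebra_simps)
    have "x - x' \<in> U" "x - x' \<in> V"
      using that xy d U V subspace_diff by metis+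
    then have "f (x - x') = g (y' - y)"
      using eq d by metis
    then have "f x - f x' = g y' - g y"
      using lin_diff[OF U f] lin_diff[OF V g] that xy by simp
    with xy(4) show ?thesis by (simp add: algebra_simps)
  qed
  have "h x = f x" if "x \<in> U" for x
    using h[of x 0] that lin_zero[OF V g] subspace_0[OF V] by simp
  moreover have "h x = g x" if "x \<in> V" for x
    using h[of 0 x] that lin_zero[OF U f] subspace_0[OF U] by simp
  moreover have "lin {x + y | x y. x \<in> U \<and> y \<in> V} W h"
    unfolding linear_between_def
  proof (intro conjI ballI allI)
    fix z assume "z \<in> {x + y | x y. x \<in> U \<and> y \<in> V}"
    then obtain x y where z: "x \<in> U" "y \<in> V" "z = x + y" by blast
    then show "h z \<in> W"
      using h W linear_betweenD(1)[OF f] linear_betweenD(1)[OF g] subspace_add by metis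
    fix c
    have "h (c *s x + c *s y) = f (c *s x) + g (c *s y)"
      using h z U V subspace_scale by blast
    then show "h (c *s z) = c *s h z"
      using h[OF z(1,2)] z by (simp add: linear_betweenD(3)[OF f] linear_betweenD(3)[OF g] scale_right_distrib)
  next
    fix z z' assume "z \<in> {x + y | x y. x \<in> U \<and> y \<in> V}" "z' \<in> {x + y | x y. x \<in> U \<and> y \<in> V}"
    then obtain x y x' y' where z: "x \<in> U" "y \<in> V" "z = x + y" "x' \<in> U" "y' \<in> V" "z' = x' + y'"
      by blast
    have "h ((x + x') + (y + y')) = f (x + x') + g (y + y')"
      using h z U V subspace_add by blast
    then show "h (z + z') = h z + h z'"
      using h[OF z(1,2)] h[OF z(4,5)] z
      by (simp add: linear_betweenD(2)[OF f] linear_betweenD(2)[OF g] algebra_simps)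
  qed
  ultimately show thesis
    using that by blast
qed

text \<open>The chain is climbed from below. If \<open>U\<close> is the last member already treated,
  its map and \<open>G\<close> on \<open>A \<inter> C\<close> agree on the overlap, are glued on the
  sum of these two subspaces, and the result is extended to the next member \<open>C\<close> by
  choosing lifts. Earlier members lie in \<open>U\<close>, where nothing changes any more: this is
  the use of nestedness. Prefixing \<open>{0}\<close> to \<open>L\<close> gives the induction its
  start.\<close>

lemma flag_extension:
  assumes A: "subspace A" "A \<subseteq> V" and G: "lin A V G" and f: "lin V W f" and H: "lin W W H"
    and comm: "\<And>a. a \<in> A \<Longrightarrow> f (G a) = H (f a)"
    and L: "\<And>C. C \<in> set L \<Longrightarrow> subspace C \<and> C \<subseteq> V" "sorted_wrt (\<subseteq>) L"
    and presG: "\<And>C x. C \<in> set L \<Longrightarrow> x \<in> A \<Longrightarrow> x \<in> C \<Longrightarrow> G x \<in> C"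
    and presH: "\<And>C x. C \<in> set L \<Longrightarrow> x \<in> C \<Longrightarrow> H (f x) \<in> f ` C"
    and V: "subspace V"
  obtains e where "lin (last ({0} # L)) (last ({0} # L)) e"
    and "\<And>x. x \<in> A \<Longrightarrow> x \<in> last ({0} # L) \<Longrightarrow> e x = G x"
    and "\<And>x. x \<in> last ({0} # L) \<Longrightarrow> f (e x) = H (f x)"
    and "\<And>C x. C \<in> set L \<Longrightarrow> x \<in> C \<Longrightarrow> e x \<in> C"
proof -
  have "\<exists>e. lin (last ({0} # L)) (last ({0} # L)) e \<and>
      (\<forall>x \<in> A \<inter> last ({0} # L). e x = G x) \<and> (\<forall>x \<in> last ({0} # L). f (e x) = H (f x)) \<and>
      (\<forall>C \<in> set L. \<forall>x \<in> C. e x \<in> C)"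
    using L presG presH
  proof (induction L rule: rev_induct)
    case Nil
    have 0: "G 0 = 0" "f 0 = 0"
      using lin_zero[OF A(1) G] lin_zero[OF V f] .
    moreover have "H 0 = 0"
      using comm[OF subspace_0[OF A(1)]] 0 by simp
    ultimately show ?case
      by (intro exI[of _ "\<lambda>x. 0"]) (simp add: linear_between_def)
  next
    case (snoc C L)
    define U where "U = last ({0} # L)"
    have "\<exists>e. lin U U e \<and> (\<forall>x \<in> A \<inter> U. e x = G x) \<and> (\<forall>x \<in> U. f (e x) = H (f x)) \<and>
        (\<forall>C \<in> set L. \<forall>x \<in> C. e x \<in> C)"
      unfolding U_def using snoc.prems by (intro snoc.IH) (simp_all add: sorted_wrt_append)
    then obtain e where "lin U U e" "\<forall>x \<in> A \<inter> U. e x = G x"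
      "\<forall>x \<in> U. f (e x) = H (f x)" "\<forall>C \<in> set L. \<forall>x \<in> C. e x \<in> C"
      by (elim exE conjE)
    then have e: "lin U U e" "\<And>x. x \<in> A \<Longrightarrow> x \<in> U \<Longrightarrow> e x = G x"
      "\<And>x. x \<in> U \<Longrightarrow> f (e x) = H (f x)" "\<And>C x. C \<in> set L \<Longrightarrow> x \<in> C \<Longrightarrow> e x \<in> C"
      by simp_all
    have C: "subspace C" "C \<subseteq> V"
      using snoc.prems by auto
    have U: "subspace U" "U \<subseteq> C"
    proof -
      have "U \<in> set L \<or> U = {0}"
        unfolding U_def by auto
      then show "subspace U" "U \<subseteq> C"
        using snoc.prems C subspace_0[OF C(1)] by (auto simp: sorted_wrt_append)
    qed
    have AC: "subspace (A \<inter> C)"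
      using A C by (simp add: subspace_inter)
    have GC: "lin (A \<inter> C) C G"
      using G snoc.prems(3)[of C] by (auto simp: linear_between_def)
    obtain k where k: "lin {x + y | x y. x \<in> U \<and> y \<in> A \<inter> C} C k"
      "\<And>x. x \<in> U \<Longrightarrow> k x = e x" "\<And>x. x \<in> A \<inter> C \<Longrightarrow> k x = G x"
      using glue[OF U(1) AC lin_subset[OF e(1) order.refl U(2)] GC C(1)] e(2) by auto
    let ?S = "{x + y | x y. x \<in> U \<and> y \<in> A \<inter> C}"
    have S: "subspace ?S" "?S \<subseteq> C"
      using subspace_sums[OF U(1) AC] U C subspace_add by auto
    have Hf: "lin C W (\<lambda>x. H (f x))"
      using lin_subset[OF linear_between_compose[OF f H] C(2)] by simp
    have kk: "f (k x) = H (f x)" if xS: "x \<in> ?S" for x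
    proof -
      obtain u a where x: "u \<in> U" "a \<in> A" "a \<in> C" "x = u + a"
        using xS by blast
      have mem: "u \<in> ?S" "a \<in> ?S" "u \<in> V" "a \<in> V"
      proof -
        have "u = u + 0" "a = 0 + a" by auto
        then show "u \<in> ?S" "a \<in> ?S"
          using x subspace_0[OF AC] subspace_0[OF U(1)] by blast+
      qed (use x U C in auto)
      have "f (k x) = f (k u + k a)"
        using linear_betweenD(2)[OF k(1) mem(1,2)] x by simp
      also have "\<dots> = f (k u) + f (k a)"
      proof -
        have "k u \<in> V" "k a \<in> V"
          using mem linear_betweenD(1)[OF k(1)] C by blast+
        then show ?thesis
          by (rule linear_betweenD(2)[OF f])
      qed
      also have "\<dots> = H (f u) + H (f a)"
        using x k(2)[of u] k(3)[of a] e(3)[of u] comm[of a] by auto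
      also have "\<dots> = H (f x)"
        using mem x(4) linear_betweenD(1,2)[OF f] linear_betweenD(2)[OF H] by simp
      finally show ?thesis .
    qed
    \<comment> \<open>\<open>presH\<close> provides preimages inside \<open>C\<close> itself, so the
      extension maps \<open>C\<close> to \<open>C\<close>.\<close>
    obtain g where g: "lin C C g" "\<And>x. x \<in> ?S \<Longrightarrow> g x = k x" "\<And>x. x \<in> C \<Longrightarrow> f (g x) = H (f x)"
      using lift_extend[OF C(1) S C(1) k(1) lin_subset[OF f C(2) order.refl] Hf kk] snoc.prems(4)
      by auto
    have gU: "g x = e x" if "x \<in> U" for x
    proof -
      have "x + 0 \<in> ?S"
        using that subspace_0[OF AC] by blast
      then show ?thesis
        using g(2) k(2) that by simp
    qed
    have gA: "g x = G x" if "x \<in> A" "x \<in> C" for x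
    proof -
      have "0 + x \<in> ?S"
        using that subspace_0[OF U(1)] by blast
      then show ?thesis
        using g(2) k(3) that by simp
    qed
    have sub: "D \<subseteq> U" if "D \<in> set L" for D
      using sorted_wrt_subset_last[of L D] snoc.prems(2) that by (auto simp: U_def sorted_wrt_append)
    have "g x \<in> D" if "D \<in> set L" "x \<in> D" for D x
      using gU[of x] e(4)[OF that] sub[OF that(1)] that(2) by auto
    then have "\<forall>D \<in> set (L @ [C]). \<forall>x \<in> D. g x \<in> D"
      using linear_betweenD(1)[OF g(1)] by simp
    with g gA show ?case
      by (intro exI[of _ g]) auto
  qed
  then obtain e where e: "lin (last ({0} # L)) (last ({0} # L)) e"
      "\<forall>x \<in> A \<inter> last ({0} # L). e x = G x" "\<forall>x \<in> last ({0} # L). f (e x) = H (f x)"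
      "\<forall>C \<in> set L. \<forall>x \<in> C. e x \<in> C"
    by (elim exE conjE)
  show thesis
    by (rule that[OF e(1)]) (use e(2-4) in blast)+
qed

text \<open>Some single power, with exponent \<open>N\<close>, kills all of \<open>W\<close>. On its
  image \<open>R\<close> the map \<open>e\<close> is injective, hence onto by dimension, so
  \<open>R\<close> is \<open>W'\<close>; subtracting from \<open>x\<close> the vector of
  \<open>R\<close> with the same value under that power leaves an element of \<open>W\<close>. The
  two subspaces are described without \<open>N\<close> because such exponents vary from point to
  point of a module, while these descriptions are carried along by structure maps.\<close>

lemma fitting:
  assumes V: "subspace V" and fin: "finite B0" "V \<subseteq> span B0" and e: "lin V V e"
  defines "W \<equiv> {x \<in> V. \<exists>n. (e ^^ n) x = 0}" and "W' \<equiv> {x \<in> V. \<forall>n. x \<in> (e ^^ n) ` V}"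
  shows "subspace W" and "subspace W'" and "W \<inter> W' = {0}"
    and "\<And>x. x \<in> V \<Longrightarrow> \<exists>w\<in>W. \<exists>w'\<in>W'. x = w + w'"
proof -
  note en = linear_between_funpow[OF e]
  have zero: "(e ^^ n) 0 = 0" for n
    using lin_zero[OF V en] .
  have mono: "(e ^^ m) x = 0" if "(e ^^ n) x = 0" "n \<le> m" for n m x
  proof -
    have "(e ^^ m) x = (e ^^ (m - n)) ((e ^^ n) x)"
      using that(2) by (metis comp_apply funpow_add le_add_diff_inverse2)
    then show ?thesis
      using that zero by simp
  qed
  show W: "subspace W"
  proof (rule subspaceI)
    show "0 \<in> W"
      using subspace_0[OF V] zero by (auto simp: W_def)
  next
    fix x y assume "x \<in> W" "y \<in> W"
    then obtain n m where nm: "x \<in> V" "y \<in> V" "(e ^^ n) x = 0" "(e ^^ m) y = 0"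
      by (auto simp: W_def)
    then have "(e ^^ (max n m)) (x + y) = 0"
      using mono[of n x "max n m"] mono[of m y "max n m"] linear_betweenD(2)[OF en] by simp
    then show "x + y \<in> W"
      using nm subspace_add[OF V] by (auto simp: W_def)
  next
    fix c x assume "x \<in> W"
    then show "c *s x \<in> W"
      using linear_betweenD(3)[OF en] subspace_scale[OF V] by (auto simp: W_def)
  qed
  have fin_basis: "\<exists>B. finite B \<and> B \<subseteq> U \<and> U = span B \<and> independent B" if "subspace U" "U \<subseteq> V" for U
  proof -
    obtain B where B: "B \<subseteq> U" "independent B" "U \<subseteq> span B"
      using maximal_independent_subset by blast
    have "finite B"
      using independent_span_bound[OF fin(1) B(2)] B(1) that fin(2) by auto
    then show ?thesis
      using B that span_minimal[OF B(1) that(1)] by blast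
  qed
  obtain N where N: "\<And>x. x \<in> W \<Longrightarrow> (e ^^ N) x = 0"
  proof -
    obtain B where B: "finite B" "B \<subseteq> W" "W = span B"
      using fin_basis[OF W] by (auto simp: W_def)
    have "\<forall>b\<in>B. \<exists>n. (e ^^ n) b = 0"
      using B by (auto simp: W_def)
    then obtain n where n: "\<And>b. b \<in> B \<Longrightarrow> (e ^^ n b) b = 0"
      by metis
    \<comment> \<open>Nilpotency is given vector by vector; a finite basis of \<open>W\<close>
      supplies a common exponent.\<close>
    define N where "N = Max (n ` B)"
    have NB: "(e ^^ N) b = 0" if "b \<in> B" for b
      using mono[OF n[OF that]] that B by (simp add: N_def)
    have "W \<subseteq> {x \<in> V. (e ^^ N) x \<in> {0}}"
      unfolding B(3)
    proof (rule span_minimal)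
      show "B \<subseteq> {x \<in> V. (e ^^ N) x \<in> {0}}"
        using NB B by (auto simp: W_def)
      show "subspace {x \<in> V. (e ^^ N) x \<in> {0}}"
        by (rule lin_vimage_subspace[OF V en]) (rule subspace_single_0)
    qed
    with that show thesis by blast
  qed
  define R where "R = (e ^^ N) ` V"
  have RV: "R \<subseteq> V"
    using linear_betweenD(1)[OF en] by (auto simp: R_def)
  have R: "subspace R"
    unfolding R_def by (rule lin_image_subspace[OF V en])
  have eR: "e ` R \<subseteq> R"
    unfolding R_def using linear_betweenD(1)[OF e] by (auto simp: funpow_swap1)
  have inj: "x = 0" if xR: "x \<in> R" "e x = 0" for x
  proof -
    obtain y where y: "y \<in> V" "x = (e ^^ N) y"
      using xR(1) by (auto simp: R_def)
    then have "(e ^^ Suc N) y = 0"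
      using xR(2) by simp
    then have "y \<in> W"
      using y unfolding W_def by blast
    then show ?thesis
      using N y by simp
  qed
  \<comment> \<open>Injectivity turns a basis of \<open>R\<close> into an independent set of the
    same size inside \<open>R\<close>. A basis vector outside its span could be added to it and
    would make it too large.\<close>
  have onto: "e ` R = R"
  proof -
    obtain B where B: "finite B" "B \<subseteq> R" "R = span B" "independent B"
      using fin_basis[OF R RV] by blast
    obtain g where g: "Vector_Spaces.linear scale scale g" "\<And>x. x \<in> V \<Longrightarrow> g x = e x"
      using extend_to_linear[OF V e] by blast
    interpret g: Vector_Spaces.linear scale scale g by (fact g)
    have "inj_on g (span B)"
    proof (rule inj_onI)
      fix x y assume "x \<in> span B" "y \<in> span B" "g x = g y"
      then have "x - y \<in> R" "g (x - y) = 0"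
        using B(3) R subspace_diff by (auto simp: g.diff)
      then have "x - y = 0"
        using inj[of "x - y"] g(2)[of "x - y"] RV by force
      then show "x = y" by simp
    qed
    then have ind: "independent (g ` B)"
      by (rule g.independent_injective_image[OF B(4)])
    have card: "card (g ` B) = card B"
      using \<open>inj_on g (span B)\<close> B(2,3) by (metis card_image inj_on_subset)
    have gR: "g ` R = e ` R"
      using g(2) RV by (intro image_cong) auto
    have "g ` B \<subseteq> span B"
      using B(2,3) gR eR by blast
    have "b \<in> span (g ` B)" if b: "b \<in> B" for b
    proof (rule ccontr)
      assume nb: "b \<notin> span (g ` B)"
      then have "independent (insert b (g ` B))"
        using ind by (rule independent_insertI)
      moreover have "insert b (g ` B) \<subseteq> span B"
        using \<open>g ` B \<subseteq> span B\<close> b span_base by blast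
      ultimately have "card (insert b (g ` B)) \<le> card B"
        using independent_span_bound[OF B(1)] by blast
      moreover have "b \<notin> g ` B"
        using nb span_base by blast
      ultimately show False
        using B(1) card by simp
    qed
    then have "B \<subseteq> span (g ` B)"
      by blast
    then have "R \<subseteq> span (g ` B)"
      unfolding B(3) by (rule span_minimal) (rule subspace_span)
    also have "\<dots> = g ` R"
      using g.span_image B(3) by metis
    finally show ?thesis
      using gR eR by blast
  qed
  have ontoN: "(e ^^ n) ` R = R" for n
  proof (induction n)
    case (Suc n)
    have "(e ^^ Suc n) ` R = e ` ((e ^^ n) ` R)"
      by (simp add: image_comp)
    then show ?case
      by (simp only: Suc onto)
  qed simp
  have W'R: "W' = R"
  proof
    show "W' \<subseteq> R"
      by (auto simp: W'_def R_def)
    have "R \<subseteq> (e ^^ n) ` V" for n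
      using image_mono[OF RV, of "e ^^ n"] by (simp only: ontoN)
    then show "R \<subseteq> W'"
      using RV unfolding W'_def by blast
  qed
  then show "subspace W'"
    using R by simp
  show "W \<inter> W' = {0}"
  proof
    show "{0} \<subseteq> W \<inter> W'"
      using subspace_0[OF W] subspace_0[OF R] W'R by simp
    have "x = 0" if "(e ^^ n) x = 0" "x \<in> R" for n x
      using that
    proof (induction n)
      case (Suc n)
      have "(e ^^ n) x \<in> R"
        using ontoN Suc by blast
      then show ?case
        using Suc inj[of "(e ^^ n) x"] by simp
    qed simp
    then show "W \<inter> W' \<subseteq> {0}"
      by (auto simp: W_def W'R)
  qed
  fix x assume x: "x \<in> V"
  then have "(e ^^ N) x \<in> (e ^^ N) ` R"
    using ontoN by (simp add: R_def)
  then obtain w' where w': "w' \<in> R" "(e ^^ N) x = (e ^^ N) w'"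
    by blast
  have "w' \<in> V"
    using w'(1) RV by blast
  then have "(e ^^ N) (x - w') = 0"
    using lin_diff[OF V en x] w'(2) by simp
  then have "x - w' \<in> W"
    using x w' RV subspace_diff[OF V] by (auto simp: W_def)
  then show "\<exists>w\<in>W. \<exists>w'\<in>W'. x = w + w'"
    using w'(1) W'R by (intro bexI[of _ "x - w'"] bexI[of _ w']) simp_all
qed

end

section \<open>Endomorphisms of a corner of the grid\<close>

text \<open>
  An endomorphism at \<open>(i, j)\<close> can be continued along \<open>R\<close> only if it preserves kernels of \<open>R\<close>, and it
  can be lifted along \<open>D\<close> only if it preserves images of \<open>D\<close>.  Iterating both requirements
  gives the subspaces collected here; the first numeric argument bounds the number of iterations.
\<close>
primrec flags :: "(nat \<Rightarrow> nat \<Rightarrow> 'v::zero set) \<Rightarrow> (nat \<Rightarrow> nat \<Rightarrow> 'v \<Rightarrow> 'v) \<Rightarrow> (nat \<Rightarrow> nat \<Rightarrow> 'v \<Rightarrow> 'v)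
    \<Rightarrow> nat \<Rightarrow> nat \<Rightarrow> nat \<Rightarrow> 'v set list" where
  "flags V R D 0 i j = [{0}, V i j]"
| "flags V R D (Suc n) i j =
     map (\<lambda>C. D i j ` C) (flags V R D n (Suc i) j) @
     map (\<lambda>C. {x \<in> V i j. R i j x \<in> C}) (flags V R D n i (Suc j)) @ [V i j]"

text \<open>At \<open>(0, 0)\<close> the first equation wins, so the hole receives the value of the
  axis \<open>j = 0\<close>. This does no harm in the application, where the space at the hole is
  zero.\<close>

fun grid_rec :: "'a \<Rightarrow> 'a \<Rightarrow> (nat \<Rightarrow> nat \<Rightarrow> 'a \<Rightarrow> 'a \<Rightarrow> 'a) \<Rightarrow> nat \<Rightarrow> nat \<Rightarrow> 'a" where
  "grid_rec a b s i 0 = a"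
| "grid_rec a b s 0 (Suc j) = b"
| "grid_rec a b s (Suc i) (Suc j) = s i j (grid_rec a b s (Suc i) j) (grid_rec a b s i (Suc j))"

text \<open>
  The grid is the quadrant to the upper left or to the lower right of a hole at \<open>(0, 0)\<close>: the
  points \<open>(i, 0)\<close> lie below the hole, the points \<open>(0, j)\<close> above it, the other ones are incomparable to it.
\<close>
locale corner_grid = ambient_space scale
  for scale :: "'k::field \<Rightarrow> 'v::ab_group_add \<Rightarrow> 'v" (infixr "*s" 75) +
  fixes V :: "nat \<Rightarrow> nat \<Rightarrow> 'v set" and R D :: "nat \<Rightarrow> nat \<Rightarrow> 'v \<Rightarrow> 'v" and n :: nat
  assumes V: "subspace (V i j)"
    and R: "lin (V i j) (V i (Suc j)) (R i j)"
    and D: "lin (V (Suc i) j) (V i j) (D i j)"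
    and comm: "x \<in> V (Suc i) j \<Longrightarrow> R i j (D i j x) = D i (Suc j) (R (Suc i) j x)"
    and V00: "V 0 0 = {0}"
    and RD: "i > 0 \<Longrightarrow> j > 0 \<Longrightarrow> x \<in> V (Suc i) j \<Longrightarrow> R i j (D i j x) = 0"
    and bounded: "i > 0 \<Longrightarrow> j > 0 \<Longrightarrow> n < i + j \<Longrightarrow> V i j = {0}"
begin

abbreviation "fl \<equiv> flags V R D"

lemma flags_subspace: "C \<in> set (fl m i j) \<Longrightarrow> subspace C \<and> C \<subseteq> V i j"
proof (induction m arbitrary: i j C)
  case 0
  then show ?case
    using V subspace_0 by auto
next
  case (Suc m)
  consider (image) C' where "C' \<in> set (fl m (Suc i) j)" "C = D i j ` C'"
    | (preimage) C' where "C' \<in> set (fl m i (Suc j))" "C = {x \<in> V i j. R i j x \<in> C'}"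
    | (all) "C = V i j"
    using Suc.prems by auto
  then show ?case
  proof cases
    case image
    have C': "subspace C'" "C' \<subseteq> V (Suc i) j"
      using Suc.IH[OF image(1)] by auto
    have "lin C' (V i j) (D i j)"
      using lin_subset[OF D C'(2)] by simp
    then show ?thesis
      using lin_image_subspace[OF C'(1)] linear_betweenD(1) image(2) by blast
  next
    case preimage
    then show ?thesis
      using lin_vimage_subspace[OF V R] Suc.IH by auto
  qed (simp add: V)
qed

text \<open>Through this member the preimages of the next round contain the kernel of
  \<open>R\<close>, so that preservation of kernels becomes a part of
  \<open>admissible\<close>.\<close>

lemma zero_in_flags: "{0} \<in> set (fl m i j)"
proof (induction m arbitrary: i j)
  case (Suc m)
  have "{0} = D i j ` {0}"
    using lin_zero[OF V D] by simp
  then have "{0} \<in> (\<lambda>C. D i j ` C) ` set (fl m (Suc i) j)"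
    using Suc by (rule image_eqI)
  then show ?case
    by simp
qed simp

lemma last_flags: "last ({0} # fl m i j) = V i j"
  by (cases m) auto

text \<open>It is here that the vanishing of \<open>R \<circ> D\<close> is essential: images of \<open>D\<close> lie in the kernel of \<open>R\<close>.\<close>
lemma sorted_flags: "i > 0 \<Longrightarrow> j > 0 \<Longrightarrow> sorted_wrt (\<subseteq>) (fl m i j)"
proof (induction m arbitrary: i j)
  case 0
  then show ?case
    using subspace_0[OF V] by simp
next
  case (Suc m)
  have 1: "sorted_wrt (\<subseteq>) (map (\<lambda>C. D i j ` C) (fl m (Suc i) j))"
    unfolding sorted_wrt_map by (rule sorted_wrt_mono_rel[OF _ Suc.IH]) (use Suc.prems in auto)
  have 2: "sorted_wrt (\<subseteq>) (map (\<lambda>C. {x \<in> V i j. R i j x \<in> C}) (fl m i (Suc j)))"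
    unfolding sorted_wrt_map by (rule sorted_wrt_mono_rel[OF _ Suc.IH]) (use Suc.prems in auto)
  have 3: "D i j ` C \<subseteq> {x \<in> V i j. R i j x \<in> C'}"
    if C: "C \<in> set (fl m (Suc i) j)" "C' \<in> set (fl m i (Suc j))" for C C'
  proof
    fix y assume "y \<in> D i j ` C"
    then obtain x where x: "x \<in> V (Suc i) j" "y = D i j x"
      using flags_subspace[OF C(1)] by blast
    have "0 \<in> C'"
      using flags_subspace[OF C(2)] subspace_0 by blast
    then show "y \<in> {x \<in> V i j. R i j x \<in> C'}"
      using x RD[OF Suc.prems x(1)] linear_betweenD(1)[OF D] by simp
  qed
  have 4: "D i j ` C \<subseteq> V i j" if "C \<in> set (fl m (Suc i) j)" for C
    using flags_subspace[OF that] linear_betweenD(1)[OF D] by blast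
  show ?case
    using 1 2 3 4 by (auto simp: sorted_wrt_append)
qed

text \<open>The number of iterations drops by one with each step away from the hole, matching the
  recursion of \<open>flags\<close>: preserving the flags at a point yields what the next point
  needs. Truncation at 0 is harmless, since the inner spaces beyond \<open>n\<close> are
  zero.\<close>

definition admissible :: "nat \<Rightarrow> nat \<Rightarrow> ('v \<Rightarrow> 'v) \<Rightarrow> bool" where
  "admissible i j e \<longleftrightarrow> lin (V i j) (V i j) e \<and> (\<forall>C \<in> set (fl (n - (i + j)) i j). \<forall>x \<in> C. e x \<in> C)"

text \<open>\<open>el\<close> and \<open>eb\<close> live at two neighbours of the point
  \<open>(Suc i, Suc j)\<close>: \<open>el\<close> at \<open>(Suc i, j)\<close>, whose map
  \<open>R\<close> leads into it, and \<open>eb\<close> at \<open>(i, Suc j)\<close>, the target of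
  its map \<open>D\<close>.\<close>

definition compatible :: "nat \<Rightarrow> nat \<Rightarrow> ('v \<Rightarrow> 'v) \<Rightarrow> ('v \<Rightarrow> 'v) \<Rightarrow> ('v \<Rightarrow> 'v) \<Rightarrow> bool" where
  "compatible i j el eb e \<longleftrightarrow> admissible (Suc i) (Suc j) e \<and>
     (\<forall>x \<in> V (Suc i) j. e (R (Suc i) j x) = R (Suc i) j (el x)) \<and>
     (\<forall>x \<in> V (Suc i) (Suc j). eb (D i (Suc j) x) = D i (Suc j) (e x))"

text \<open>The new map is dictated on the image of \<open>R\<close> by \<open>el\<close> and modulo
  the kernel of \<open>D\<close> by \<open>eb\<close>; the square hypothesis says that both
  prescriptions agree. The flags preserved by \<open>el\<close> and \<open>eb\<close> let
  \<open>flag_extension\<close> meet both and preserve the flags of the new point.\<close>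

lemma compatible_exists:
  assumes el: "admissible (Suc i) j el" and eb: "admissible i (Suc j) eb"
    and sq: "\<And>x. x \<in> V (Suc i) j \<Longrightarrow>
      eb (D i (Suc j) (R (Suc i) j x)) = D i (Suc j) (R (Suc i) j (el x))"
  shows "\<exists>e. compatible i j el eb e"
proof (cases "Suc i + Suc j \<le> n")
  case False
  then have V0: "V (Suc i) (Suc j) = {0}"
    by (intro bounded) auto
  have eb_lin: "lin (V i (Suc j)) (V i (Suc j)) eb" and el_lin: "lin (V (Suc i) j) (V (Suc i) j) el"
    using el eb by (auto simp: admissible_def)
  have "R (Suc i) j x = 0" if "x \<in> V (Suc i) j" for x
    using linear_betweenD(1)[OF R that] V0 by simp
  moreover have "D i (Suc j) 0 = 0" "eb 0 = 0"
    using lin_zero[OF V D] lin_zero[OF V eb_lin] .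
  moreover have "0 \<in> C" if "C \<in> set (fl m (Suc i) (Suc j))" for C m
    using flags_subspace[OF that] subspace_0 by blast
  ultimately have "compatible i j el eb (\<lambda>_. 0)"
    using linear_betweenD(1)[OF el_lin]
    by (simp add: compatible_def admissible_def V0 linear_between_def)
  then show ?thesis by blast
next
  case True
  define m where "m = n - (Suc i + Suc j)"
  \<comment> \<open>Both neighbours have one iteration more than the new point, so their flags
    contain the preimages under \<open>R\<close> and the images under \<open>D\<close> of its
    flags.\<close>
  have fuel: "n - (Suc i + j) = Suc m" "n - (i + Suc j) = Suc m"
    using True by (auto simp: m_def)
  let ?U = "V (Suc i) j" and ?P = "V (Suc i) (Suc j)" and ?r = "R (Suc i) j" and ?f = "D i (Suc j)"
  let ?L = "fl m (Suc i) (Suc j)"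
  have eb_lin: "lin (V i (Suc j)) (V i (Suc j)) eb" and el_lin: "lin ?U ?U el"
    using el eb by (auto simp: admissible_def)
  have el_flag: "el x \<in> C" if "C \<in> set (fl (Suc m) (Suc i) j)" "x \<in> C" for x C
    using el that by (simp only: admissible_def fuel)
  have eb_flag: "eb x \<in> C" if "C \<in> set (fl (Suc m) i (Suc j))" "x \<in> C" for x C
    using eb that by (simp only: admissible_def fuel)
  have el_pres: "?r (el x) \<in> C" if "x \<in> ?U" "?r x \<in> C" "C \<in> set ?L" for x C
  proof -
    have "{x \<in> ?U. ?r x \<in> C} \<in> (\<lambda>C. {x \<in> ?U. ?r x \<in> C}) ` set ?L"
      using that(3) by (rule imageI)
    then have "el x \<in> {x \<in> ?U. ?r x \<in> C}"
      using that(1,2) by (intro el_flag) simp_all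
    then show ?thesis by simp
  qed
  have eb_pres: "eb (?f x) \<in> ?f ` C" if "x \<in> C" "C \<in> set ?L" for x C
  proof -
    have "?f ` C \<in> (\<lambda>C. ?f ` C) ` set ?L"
      using that(2) by (rule imageI)
    then show ?thesis
      using that(1) by (intro eb_flag) simp_all
  qed
  \<comment> \<open>The value forced on the image of \<open>R\<close>; the choice of preimage does
    not matter because \<open>el\<close> preserves the kernel of \<open>R\<close>.\<close>
  define G where "G a = ?r (el (SOME x. x \<in> ?U \<and> ?r x = a))" for a
  have G: "G (?r x) = ?r (el x)" if x: "x \<in> ?U" for x
  proof -
    define y where "y = (SOME y. y \<in> ?U \<and> ?r y = ?r x)"
    have y: "y \<in> ?U" "?r y = ?r x"
      unfolding y_def using someI[of "\<lambda>y. y \<in> ?U \<and> ?r y = ?r x" x] x by auto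
    have "?r (el (y - x)) \<in> {0}"
      using el_pres[of "y - x" "{0}"] zero_in_flags lin_diff[OF V R y(1) x] y x subspace_diff[OF V]
      by simp
    moreover have "?r (el (y - x)) = ?r (el y) - ?r (el x)"
      using lin_diff[OF V el_lin y(1) x] lin_diff[OF V R] linear_betweenD(1)[OF el_lin] x y by simp
    ultimately show ?thesis
      by (simp add: G_def y_def)
  qed
  let ?A = "?r ` ?U"
  have A: "subspace ?A" "?A \<subseteq> ?P"
  proof -
    show "subspace ?A"
      by (rule lin_image_subspace[OF V R])
    show "?A \<subseteq> ?P"
      using linear_betweenD(1)[OF R] by blast
  qed
  have G_lin: "lin ?A ?P G"
    unfolding linear_between_def
  proof (intro conjI ballI allI)
    fix a assume "a \<in> ?A"
    then obtain x where x: "x \<in> ?U" "a = ?r x" by blast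
    then show "G a \<in> ?P"
      using G linear_betweenD(1)[OF R] linear_betweenD(1)[OF el_lin] by simp
    fix c
    have "G (?r (c *s x)) = ?r (el (c *s x))"
      using G subspace_scale[OF V] x by blast
    then show "G (c *s a) = c *s G a"
      using x G[OF x(1)] linear_betweenD(1,3)[OF el_lin] linear_betweenD(3)[OF R] by simp
  next
    fix a b assume "a \<in> ?A" "b \<in> ?A"
    then obtain x y where x: "x \<in> ?U" "a = ?r x" "y \<in> ?U" "b = ?r y" by blast
    have "G (?r (x + y)) = ?r (el (x + y))"
      using G subspace_add[OF V] x by blast
    then show "G (a + b) = G a + G b"
      using x G[OF x(1)] G[OF x(3)] linear_betweenD(1,2)[OF el_lin] linear_betweenD(2)[OF R] by simp
  qed
  have pos: "0 < Suc i" "0 < Suc j" by auto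
  have comm_A: "?f (G a) = eb (?f a)" if a: "a \<in> ?A" for a
  proof -
    obtain x where "x \<in> ?U" "a = ?r x"
      using a by blast
    then show ?thesis
      using G sq by simp
  qed
  have presG: "G a \<in> C" if a: "C \<in> set ?L" "a \<in> ?A" "a \<in> C" for C a
  proof -
    obtain x where "x \<in> ?U" "a = ?r x"
      using a(2) by blast
    then show ?thesis
      using G el_pres a by simp
  qed
  have flag: "subspace C \<and> C \<subseteq> ?P" if "C \<in> set ?L" for C
    using flags_subspace[OF that] .
  show ?thesis
  proof (rule flag_extension[where L = ?L, OF A G_lin D eb_lin comm_A flag sorted_flags[OF pos]
        presG eb_pres V, unfolded last_flags])
    fix e assume e: "lin ?P ?P e" "\<And>a. a \<in> ?A \<Longrightarrow> a \<in> ?P \<Longrightarrow> e a = G a"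
      "\<And>x. x \<in> ?P \<Longrightarrow> ?f (e x) = eb (?f x)" "\<And>C x. C \<in> set ?L \<Longrightarrow> x \<in> C \<Longrightarrow> e x \<in> C"
    have "e (?r x) = ?r (el x)" if "x \<in> ?U" for x
      using e(2)[of "?r x"] linear_betweenD(1)[OF R that] G[OF that] that by simp
    then have "compatible i j el eb e"
      unfolding compatible_def admissible_def m_def[symmetric] using e(1,3,4) by simp
    then show ?thesis
      by blast
  qed
qed

text \<open>Compatibility is proved in order of increasing \<open>i + j\<close>. As squares commute,
  the square hypothesis of \<open>compatible_exists\<close> reduces to naturality of
  \<open>D\<close> into and of \<open>R\<close> out of the corner \<open>(i, j)\<close>, known from
  smaller sums or from the axes.\<close>

lemma corner_endomorphism:
  obtains e where "\<And>i j. lin (V i j) (V i j) (e i j)"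
    and "\<And>i j x. x \<in> V i j \<Longrightarrow> e i (Suc j) (R i j x) = R i j (e i j x)"
    and "\<And>i j x. x \<in> V (Suc i) j \<Longrightarrow> e i j (D i j x) = D i j (e (Suc i) j x)"
    and "\<And>i x. e i 0 x = x"
    and "\<And>j x. x \<in> V 0 j \<Longrightarrow> e 0 j x = 0"
proof -
  define e where "e = grid_rec (\<lambda>x. x) (\<lambda>x. 0) (\<lambda>i j el eb. SOME e. compatible i j el eb e)"
  have e0: "e i 0 = (\<lambda>x. x)" "e 0 (Suc j) = (\<lambda>x. 0)"
    and eS: "e (Suc i) (Suc j) = (SOME f. compatible i j (e (Suc i) j) (e i (Suc j)) f)" for i j
    by (simp_all add: e_def)
  have adm0: "admissible i 0 (e i 0)" for i
    by (simp add: e0 admissible_def linear_between_def)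
  have adm0': "admissible 0 (Suc j) (e 0 (Suc j))" for j
    using flags_subspace subspace_0 subspace_0[OF V]
    by (auto simp: e0 admissible_def linear_between_def)
  have main: "compatible i j (e (Suc i) j) (e i (Suc j)) (e (Suc i) (Suc j))" for i j
  proof (induction "i + j" arbitrary: i j rule: less_induct)
    case less
    have el: "admissible (Suc i) j (e (Suc i) j)"
    proof (cases j)
      case (Suc j')
      then show ?thesis
        using less[of i j'] by (simp add: compatible_def)
    qed (simp add: adm0)
    have eb: "admissible i (Suc j) (e i (Suc j))"
    proof (cases i)
      case (Suc i')
      then show ?thesis
        using less[of i' j] by (simp add: compatible_def)
    qed (simp add: adm0')
    \<comment> \<open>The identity axis and the zero axis meet only at the hole, where the space is
      zero.\<close>
    have natR: "e i (Suc j) (R i j x) = R i j (e i j x)" if x: "x \<in> V i j" for x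
    proof (cases i)
      case 0
      show ?thesis
      proof (cases j)
        case 0
        then show ?thesis
          using x \<open>i = 0\<close> V00 lin_zero[OF V R] by (simp add: e0)
      next
        case (Suc j')
        then show ?thesis
          using \<open>i = 0\<close> lin_zero[OF V R] by (simp add: e0)
      qed
    next
      case (Suc i')
      then show ?thesis
        using less[of i' j] x by (simp add: compatible_def)
    qed
    have natD: "e i j (D i j x) = D i j (e (Suc i) j x)" if x: "x \<in> V (Suc i) j" for x
    proof (cases j)
      case (Suc j')
      then show ?thesis
        using less[of i j'] x by (simp add: compatible_def)
    qed (simp add: e0)
    have el_lin: "lin (V (Suc i) j) (V (Suc i) j) (e (Suc i) j)"
      using el by (simp add: admissible_def)
    have "\<exists>f. compatible i j (e (Suc i) j) (e i (Suc j)) f"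
    proof (rule compatible_exists[OF el eb])
      fix x assume x: "x \<in> V (Suc i) j"
      have "e i (Suc j) (D i (Suc j) (R (Suc i) j x)) = e i (Suc j) (R i j (D i j x))"
        using comm[OF x] by simp
      also have "\<dots> = R i j (D i j (e (Suc i) j x))"
        using natR natD x linear_betweenD(1)[OF D] by simp
      also have "\<dots> = D i (Suc j) (R (Suc i) j (e (Suc i) j x))"
        using comm linear_betweenD(1)[OF el_lin x] by simp
      finally show "e i (Suc j) (D i (Suc j) (R (Suc i) j x)) = D i (Suc j) (R (Suc i) j (e (Suc i) j x))" .
    qed
    then show ?case
      unfolding eS by (rule someI_ex)
  qed
  show thesis
  proof (rule that[of e])
    show "lin (V i j) (V i j) (e i j)" for i j
    proof (cases i; cases j)
      fix i' j' assume "i = Suc i'" "j = Suc j'"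
      then show ?thesis
        using main[of i' j'] by (simp add: compatible_def admissible_def)
    qed (use adm0 adm0' in \<open>simp_all add: admissible_def\<close>)
    show "e i (Suc j) (R i j x) = R i j (e i j x)" if "x \<in> V i j" for i j x
    proof (cases i)
      case 0
      then show ?thesis
        using that V00 lin_zero[OF V R] by (cases j) (simp_all add: e0)
    next
      case (Suc i')
      then show ?thesis
        using main[of i' j] that by (simp add: compatible_def)
    qed
    show "e i j (D i j x) = D i j (e (Suc i) j x)" if "x \<in> V (Suc i) j" for i j x
    proof (cases j)
      case (Suc j')
      then show ?thesis
        using main[of i j'] that by (simp add: compatible_def)
    qed (simp add: e0)
    show "e i 0 x = x" for i x
      by (simp add: e0)
    show "e 0 j x = 0" if "x \<in> V 0 j" for j x
      using that V00 by (cases j) (simp_all add: e0)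
  qed
qed

end

section \<open>Decompositions and endomorphisms of persistence modules\<close>

lemma persistence_moduleD:
  assumes "persistence_module M"
  shows "vector_space (scl M)"
    and "module.subspace (scl M) (sp M p)"
    and "\<exists>B. finite B \<and> module.span (scl M) B = sp M p"
    and "p \<le> q \<Longrightarrow> linear_between (scl M) (scl M) (sp M p) (sp M q) (tr M p q)"
    and "x \<in> sp M p \<Longrightarrow> tr M p p x = x"
    and "p \<le> q \<Longrightarrow> q \<le> r \<Longrightarrow> x \<in> sp M p \<Longrightarrow> tr M q r (tr M p q x) = tr M p r x"
    and "fin_dim_subspace (scl M) (sp M p)"
proof -
  show fd: "fin_dim_subspace (scl M) (sp M p)"
    using assms unfolding persistence_module_def by (elim conjE) (erule spec)
  show "module.subspace (scl M) (sp M p)" "\<exists>B. finite B \<and> module.span (scl M) B = sp M p"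
    using fd by (simp_all add: fin_dim_subspace_def)
qed (use assms in \<open>simp_all add: persistence_module_def del: split_paired_All\<close>)

lemma (in ambient_space) fin_dim_subspace_subset:
  assumes "fin_dim_subspace scale V" and "subspace W" and "W \<subseteq> V"
  shows "fin_dim_subspace scale W"
proof -
  obtain B0 where B0: "finite B0" "V = span B0"
    using assms(1) by (auto simp: fin_dim_subspace_def)
  obtain B where B: "B \<subseteq> W" "independent B" "W \<subseteq> span B"
    using maximal_independent_subset by blast
  have "finite B"
    using independent_span_bound[OF B0(1) B(2)] B(1) assms(3) B0(2) by blast
  moreover have "span B = W"
    using B span_minimal[OF B(1) assms(2)] by blast
  ultimately show ?thesis
    using assms(2) by (auto simp: fin_dim_subspace_def)
qed

lemma persistence_submodule:
  assumes M: "persistence_module M"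
    and W: "\<And>p. module.subspace (scl M) (W p)" "\<And>p. W p \<subseteq> sp M p"
    and tr: "\<And>p q x. p \<le> q \<Longrightarrow> x \<in> W p \<Longrightarrow> tr M p q x \<in> W q"
  shows "persistence_module (M\<lparr>sp := W\<rparr>)"
proof -
  interpret ambient_space "scl M"
    using persistence_moduleD(1)[OF M] by (rule ambient_space.intro)
  have "fin_dim_subspace (scl M) (W p)" for p
    by (rule fin_dim_subspace_subset[OF persistence_moduleD(7)[OF M] W])
  moreover have "linear_between (scl M) (scl M) (W p) (W q) (tr M p q)" if "p \<le> q" for p q
    using persistence_moduleD(4)[OF M that] W(2)[of p] tr[OF that] unfolding linear_between_def by blast
  moreover have "tr M p p x = x" if "x \<in> W p" for p x
    using persistence_moduleD(5)[OF M] W(2) that by blast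
  moreover have "tr M q r (tr M p q x) = tr M p r x" if "p \<le> q" "q \<le> r" "x \<in> W p" for p q r x
    using persistence_moduleD(6)[OF M that(1,2)] W(2) that(3) by blast
  ultimately show ?thesis
    using persistence_moduleD(1)[OF M] by (simp add: persistence_module_def)
qed

text \<open>Decompositions are unique, so there is a projection along \<open>W'\<close>. Together
  with its complement it is an isomorphism onto an external sum whose summands are \<open>M\<close>
  with smaller spaces, as the quantification in \<open>indecomposable\<close> requires.\<close>

lemma indecomposable_internal_sum:
  assumes M: "indecomposable M"
    and W: "\<And>p. module.subspace (scl M) (W p)" "\<And>p. W p \<subseteq> sp M p"
      "\<And>p q x. p \<le> q \<Longrightarrow> x \<in> W p \<Longrightarrow> tr M p q x \<in> W q"
    and W': "\<And>p. module.subspace (scl M) (W' p)" "\<And>p. W' p \<subseteq> sp M p"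
      "\<And>p q x. p \<le> q \<Longrightarrow> x \<in> W' p \<Longrightarrow> tr M p q x \<in> W' q"
    and int: "\<And>p. W p \<inter> W' p = {0}"
    and sum: "\<And>p x. x \<in> sp M p \<Longrightarrow> \<exists>w\<in>W p. \<exists>w'\<in>W' p. x = w + w'"
  shows "(\<forall>p. W p = {0}) \<or> (\<forall>p. W' p = {0})"
proof -
  have pm: "persistence_module M"
    using M by (simp add: indecomposable_def)
  interpret ambient_space "scl M"
    using persistence_moduleD(1)[OF pm] by (rule ambient_space.intro)
  let ?N = "M\<lparr>sp := W\<rparr>" and ?N' = "M\<lparr>sp := W'\<rparr>"
  have N: "persistence_module ?N" "persistence_module ?N'"
    using persistence_submodule[OF pm W] persistence_submodule[OF pm W'] by auto
  define \<pi> where "\<pi> p x = (SOME w. w \<in> W p \<and> x - w \<in> W' p)" for p x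
  have \<pi>: "\<pi> p (w + w') = w" if w: "w \<in> W p" "w' \<in> W' p" for p w w'
  proof -
    have "\<pi> p (w + w') \<in> W p \<and> (w + w') - \<pi> p (w + w') \<in> W' p"
      unfolding \<pi>_def by (rule someI[where x = w]) (use w in simp)
    then have "\<pi> p (w + w') - w \<in> W p" "((w + w') - \<pi> p (w + w')) - w' \<in> W' p"
      using w W(1) W'(1) subspace_diff by blast+
    moreover have "((w + w') - \<pi> p (w + w')) - w' = - (\<pi> p (w + w') - w)"
      by simp
    ultimately have "\<pi> p (w + w') - w \<in> W' p"
      using subspace_neg[OF W'(1), of "- (\<pi> p (w + w') - w)"] by simp
    with \<open>\<pi> p (w + w') - w \<in> W p\<close> have "\<pi> p (w + w') - w = 0"
      using int by blast
    then show ?thesis by simp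
  qed
  define \<phi> where "\<phi> p x = (\<pi> p x, x - \<pi> p x)" for p x
  have \<phi>: "\<phi> p (w + w') = (w, w')" if "w \<in> W p" "w' \<in> W' p" for p w w'
    using \<pi>[OF that] by (simp add: \<phi>_def)
  have scale_prod: "module_prod.scale (scl M) (scl M) c (x, y) = (scl M c x, scl M c y)" for c x y
  proof -
    interpret module_prod "scl M" "scl M"
      by unfold_locales
    show ?thesis
      by (rule scale_prod)
  qed
  have "isomorphic M (direct_sum ?N ?N')"
    unfolding isomorphic_def
  proof (intro exI[of _ \<phi>] conjI allI impI ballI)
    fix p
    show "linear_between (scl M) (scl (direct_sum ?N ?N')) (sp M p) (sp (direct_sum ?N ?N') p) (\<phi> p)"
      unfolding linear_between_def
    proof (intro conjI ballI allI)
      fix x assume "x \<in> sp M p"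
      then obtain w w' where x: "w \<in> W p" "w' \<in> W' p" "x = w + w'"
        using sum by blast
      then show "\<phi> p x \<in> sp (direct_sum ?N ?N') p"
        by (simp add: direct_sum_def \<phi>)
      fix c
      have "\<phi> p (scl M c w + scl M c w') = (scl M c w, scl M c w')"
        using x W(1) W'(1) subspace_scale by (intro \<phi>) blast+
      then show "\<phi> p (scl M c x) = scl (direct_sum ?N ?N') c (\<phi> p x)"
        using x by (simp add: direct_sum_def scale_prod \<phi> scale_right_distrib)
    next
      fix x y assume "x \<in> sp M p" "y \<in> sp M p"
      then obtain w w' u u' where x: "w \<in> W p" "w' \<in> W' p" "x = w + w'" "u \<in> W p" "u' \<in> W' p" "y = u + u'"
        using sum by metis
      have "\<phi> p ((w + u) + (w' + u')) = (w + u, w' + u')"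
        using x W(1) W'(1) subspace_add by (intro \<phi>) blast+
      then show "\<phi> p (x + y) = \<phi> p x + \<phi> p y"
        using \<phi>[OF x(1,2)] \<phi>[OF x(4,5)] unfolding x(3,6) by (simp add: add_ac)
    qed
    show "bij_betw (\<phi> p) (sp M p) (sp (direct_sum ?N ?N') p)"
    proof (rule bij_betw_byWitness[where f' = "\<lambda>(w, w'). w + w'"])
      show "\<forall>x \<in> sp M p. (case \<phi> p x of (w, w') \<Rightarrow> w + w') = x"
        by (simp add: \<phi>_def)
      show "\<forall>y \<in> sp (direct_sum ?N ?N') p. \<phi> p (case y of (w, w') \<Rightarrow> w + w') = y"
        using \<phi> by (auto simp: direct_sum_def)
      show "\<phi> p ` sp M p \<subseteq> sp (direct_sum ?N ?N') p"
      proof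
        fix y assume "y \<in> \<phi> p ` sp M p"
        then obtain w w' where "w \<in> W p" "w' \<in> W' p" "y = \<phi> p (w + w')"
          using sum by blast
        then show "y \<in> sp (direct_sum ?N ?N') p"
          by (simp add: direct_sum_def \<phi>)
      qed
      show "(\<lambda>(w, w'). w + w') ` sp (direct_sum ?N ?N') p \<subseteq> sp M p"
        using W(2)[of p] W'(2)[of p] subspace_add[OF persistence_moduleD(2)[OF pm, of p]]
        by (auto simp: direct_sum_def subset_iff)
    qed
  next
    fix p q x assume pq: "(p::point) \<le> q" and "x \<in> sp M p"
    then obtain w w' where x: "w \<in> W p" "w' \<in> W' p" "x = w + w'"
      using sum by blast
    have "tr M p q x = tr M p q w + tr M p q w'"
      using x W(2) W'(2) linear_betweenD(2)[OF persistence_moduleD(4)[OF pm pq]] by blast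
    then show "\<phi> q (tr M p q x) = tr (direct_sum ?N ?N') p q (\<phi> p x)"
      using x W(3)[OF pq] W'(3)[OF pq] by (simp add: \<phi> direct_sum_def)
  qed
  then have "zero_module ?N \<or> zero_module ?N'"
    using M N unfolding indecomposable_def by blast
  then show ?thesis
    by (simp add: zero_module_def)
qed

text \<open>Naturality passes to powers, so the nilpotent parts \<open>W\<close> and the stable
  parts \<open>W'\<close> at all points form two complementary submodules. The space at
  \<open>a\<close> lies wholly in the second and the one at \<open>b\<close> wholly in the first, so
  neither submodule is zero.\<close>

lemma indecomposable_no_partial_endomorphism:
  assumes M: "indecomposable M"
    and E: "\<And>p. linear_between (scl M) (scl M) (sp M p) (sp M p) (E p)"
    and nat: "\<And>p q x. p \<le> q \<Longrightarrow> x \<in> sp M p \<Longrightarrow> E q (tr M p q x) = tr M p q (E p x)"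
    and a: "a \<in> supp M" "\<And>x. x \<in> sp M a \<Longrightarrow> E a x = x"
    and b: "b \<in> supp M" "\<And>x. x \<in> sp M b \<Longrightarrow> E b x = 0"
  shows False
proof -
  have pm: "persistence_module M"
    using M by (simp add: indecomposable_def)
  interpret ambient_space "scl M"
    using persistence_moduleD(1)[OF pm] by (rule ambient_space.intro)
  define W where "W p = {x \<in> sp M p. \<exists>n. (E p ^^ n) x = 0}" for p
  define W' where "W' p = {x \<in> sp M p. \<forall>n. x \<in> (E p ^^ n) ` sp M p}" for p
  note sub = persistence_moduleD(2)[OF pm]
  note lin = persistence_moduleD(4)[OF pm]
  have nat_pow: "(E q ^^ n) (tr M p q x) = tr M p q ((E p ^^ n) x)" if "p \<le> q" "x \<in> sp M p" for p q x n
  proof (induction n)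
    case (Suc n)
    have "(E p ^^ n) x \<in> sp M p"
      using linear_betweenD(1)[OF linear_between_funpow[OF E] that(2)] .
    then show ?case
      using Suc nat[OF that(1)] by simp
  qed simp
  have fit: "subspace (W p) \<and> subspace (W' p) \<and> W p \<inter> W' p = {0} \<and>
      (\<forall>x \<in> sp M p. \<exists>w\<in>W p. \<exists>w'\<in>W' p. x = w + w')" for p
  proof -
    obtain B where B: "finite B" "span B = sp M p"
      using persistence_moduleD(3)[OF pm] by blast
    then have "sp M p \<subseteq> span B" by simp
    from fitting[OF sub B(1) this E] show ?thesis
      unfolding W_def W'_def by blast
  qed
  have "(\<forall>p. W p = {0}) \<or> (\<forall>p. W' p = {0})"
  proof (rule indecomposable_internal_sum[OF M])
    fix p q x assume pq: "(p::point) \<le> q"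
    {
      assume "x \<in> W p"
      then obtain n where n: "x \<in> sp M p" "(E p ^^ n) x = 0"
        by (auto simp: W_def)
      then show "tr M p q x \<in> W q"
        using nat_pow[OF pq n(1), of n] lin_zero[OF sub lin[OF pq]] linear_betweenD(1)[OF lin[OF pq]]
        by (auto simp: W_def)
    next
      assume x: "x \<in> W' p"
      have "tr M p q x \<in> (E q ^^ n) ` sp M q" for n
      proof -
        obtain y where y: "y \<in> sp M p" "x = (E p ^^ n) y"
          using x by (auto simp: W'_def)
        then have "tr M p q x = (E q ^^ n) (tr M p q y)"
          using nat_pow[OF pq] by simp
        then show ?thesis
          using linear_betweenD(1)[OF lin[OF pq] y(1)] by blast
      qed
      then show "tr M p q x \<in> W' q"
        using x linear_betweenD(1)[OF lin[OF pq]] by (simp add: W'_def)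
    }
  qed (use fit in \<open>auto simp: W_def W'_def\<close>)
  moreover have "W' a = sp M a"
  proof -
    have "(E a ^^ n) x = x" if "x \<in> sp M a" for x n
      using a(2) that by (induction n) auto
    then show ?thesis
      by (force simp: W'_def)
  qed
  moreover have "W b = sp M b"
  proof -
    have "(E b ^^ 1) x = 0" if "x \<in> sp M b" for x
      using b(2) that by simp
    then show ?thesis
      unfolding W_def by blast
  qed
  ultimately have "sp M b = {0} \<or> sp M a = {0}"
    by metis
  then show False
    using a(1) b(1) by (simp add: supp_def)
qed

text \<open>\<open>R\<close> after \<open>D\<close> crosses a unit square of the open quadrant
  diagonally. With at most three support points there, one corner of the square is missing; it is an
  end of the diagonal or lies on one of the two paths around the square, and the map vanishes in
  each case.\<close>

lemma corner_of_module:
  fixes P :: "nat \<Rightarrow> nat \<Rightarrow> point"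
  assumes M: "persistence_module M" and fin: "finite (supp M)"
    and P0: "P 0 0 \<notin> supp M"
    and le: "\<And>i j. P i j \<le> P i (Suc j)" "\<And>i j. P (Suc i) j \<le> P i j"
    and inj: "\<And>i j i' j'. P i j = P i' j' \<Longrightarrow> i = i' \<and> j = j'"
    and few: "card (supp M \<inter> {P i j | i j. i > 0 \<and> j > 0}) \<le> 3"
  obtains e where
    "\<And>i j. linear_between (scl M) (scl M) (sp M (P i j)) (sp M (P i j)) (e i j)"
    and "\<And>i j x. x \<in> sp M (P i j) \<Longrightarrow>
      e i (Suc j) (tr M (P i j) (P i (Suc j)) x) = tr M (P i j) (P i (Suc j)) (e i j x)"
    and "\<And>i j x. x \<in> sp M (P (Suc i) j) \<Longrightarrow>
      e i j (tr M (P (Suc i) j) (P i j) x) = tr M (P (Suc i) j) (P i j) (e (Suc i) j x)"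
    and "\<And>i x. e i 0 x = x"
    and "\<And>j x. x \<in> sp M (P 0 j) \<Longrightarrow> e 0 j x = 0"
proof -
  interpret ambient_space "scl M"
    using persistence_moduleD(1)[OF M] by (rule ambient_space.intro)
  note sub = persistence_moduleD(2)[OF M] and lin = persistence_moduleD(4)[OF M]
    and comp = persistence_moduleD(6)[OF M]
  have zero: "tr M p q x = 0" if "p \<le> q" "x \<in> sp M p" "p \<notin> supp M \<or> q \<notin> supp M" for p q x
    using that(3)
  proof
    assume "p \<notin> supp M"
    then show ?thesis
      using lin_zero[OF sub lin[OF that(1)]] that(2) by (simp add: supp_def)
  next
    assume "q \<notin> supp M"
    then show ?thesis
      using linear_betweenD(1)[OF lin[OF that(1)] that(2)] by (simp add: supp_def)
  qed
  \<comment> \<open>As \<open>P\<close> is injective, only finitely many index pairs hit the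
    support; \<open>n\<close> bounds their sums, with 0 inserted in case there are none.\<close>
  define n where "n = Max (insert 0 ((\<lambda>(i, j). i + j) ` {(i, j). P i j \<in> supp M}))"
  have "finite {(i, j). P i j \<in> supp M}"
  proof (rule inj_on_finite[OF _ _ fin])
    show "inj_on (\<lambda>(i, j). P i j) {(i, j). P i j \<in> supp M}"
      using inj by (auto simp: inj_on_def)
  qed auto
  then have n: "i + j \<le> n" if "P i j \<in> supp M" for i j
    unfolding n_def using that by (intro Max_ge) force+
  have square: "tr M (P i j) (P i (Suc j)) (tr M (P (Suc i) j) (P i j) x)
      = tr M (P (Suc i) (Suc j)) (P i (Suc j)) (tr M (P (Suc i) j) (P (Suc i) (Suc j)) x)"
    if "x \<in> sp M (P (Suc i) j)" for i j x
    using comp[OF le(2) le(1) that] comp[OF le(1) le(2) that] by simp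
  interpret corner_grid "scl M" "\<lambda>i j. sp M (P i j)" "\<lambda>i j. tr M (P i j) (P i (Suc j))"
    "\<lambda>i j. tr M (P (Suc i) j) (P i j)" n
  proof
    show "subspace (sp M (P i j))" for i j
      by (rule sub)
    show "linear_between (scl M) (scl M) (sp M (P i j)) (sp M (P i (Suc j))) (tr M (P i j) (P i (Suc j)))"
      "linear_between (scl M) (scl M) (sp M (P (Suc i) j)) (sp M (P i j)) (tr M (P (Suc i) j) (P i j))" for i j
      using lin le by blast+
    show "tr M (P i j) (P i (Suc j)) (tr M (P (Suc i) j) (P i j) x) =
        tr M (P (Suc i) (Suc j)) (P i (Suc j)) (tr M (P (Suc i) j) (P (Suc i) (Suc j)) x)"
      if "x \<in> sp M (P (Suc i) j)" for i j x
      using square[OF that] by simp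
    show "sp M (P 0 0) = {0}"
      using P0 by (simp add: supp_def)
    show "sp M (P i j) = {0}" if "n < i + j" for i j
      using n[of i j] that by (force simp: supp_def)
    show "tr M (P i j) (P i (Suc j)) (tr M (P (Suc i) j) (P i j) x) = 0"
      if ij: "i > 0" "j > 0" and x: "x \<in> sp M (P (Suc i) j)" for i j x
    proof -
      let ?Q = "{P (Suc i) j, P i j, P (Suc i) (Suc j), P i (Suc j)}"
      have "card ?Q = 4"
        using inj[of "Suc i" j i j] inj[of "Suc i" j "Suc i" "Suc j"] inj[of "Suc i" j i "Suc j"]
          inj[of i j "Suc i" "Suc j"] inj[of i j i "Suc j"] inj[of "Suc i" "Suc j" i "Suc j"]
        by (auto simp: card_insert_if)
      moreover have "?Q \<subseteq> {P i j | i j. i > 0 \<and> j > 0}"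
        using ij by blast
      ultimately have "\<not> ?Q \<subseteq> supp M"
        using few fin card_mono[of "supp M \<inter> {P i j | i j. i > 0 \<and> j > 0}" ?Q] by auto
      then consider "P (Suc i) j \<notin> supp M" | "P i j \<notin> supp M" | "P (Suc i) (Suc j) \<notin> supp M"
        | "P i (Suc j) \<notin> supp M"
        by blast
      then show ?thesis
      proof cases
        \<comment> \<open>This corner is off the path taken by \<open>D\<close> and
          \<open>R\<close>; the other path around the square passes through it.\<close>
        case 3
        then have "tr M (P (Suc i) j) (P (Suc i) (Suc j)) x = 0"
          using zero[OF le(1) x] by blast
        moreover have "tr M (P (Suc i) (Suc j)) (P i (Suc j)) 0 = 0"
          by (rule lin_zero[OF sub lin[OF le(2)]])
        ultimately show ?thesis
          using square[OF x] by simp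
      next
        case 4
        then show ?thesis
          using zero[OF le(1) linear_betweenD(1)[OF lin[OF le(2)] x]] by blast
      next
        case 1
        then have "tr M (P (Suc i) j) (P i j) x = 0"
          using zero[OF le(2) x] by blast
        then show ?thesis
          using lin_zero[OF sub lin[OF le(1)]] by simp
      next
        case 2
        then have "tr M (P (Suc i) j) (P i j) x = 0"
          using zero[OF le(2) x] by blast
        then show ?thesis
          using lin_zero[OF sub lin[OF le(1)]] by simp
      qed
    qed
  qed
  show thesis
    by (rule corner_endomorphism) (rule that)
qed

text \<open>Every \<open>p \<le> q\<close> splits into unit steps and naturality survives
  composition, so maps across the hole need no separate treatment.\<close>

lemma natural_of_adjacent:
  assumes M: "persistence_module M"
    and E: "\<And>p x. x \<in> sp M p \<Longrightarrow> E p x \<in> sp M p"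
    and adj: "\<And>p x. x \<in> sp M p \<Longrightarrow> E (p + (1, 0)) (tr M p (p + (1, 0)) x) = tr M p (p + (1, 0)) (E p x)"
      "\<And>p x. x \<in> sp M p \<Longrightarrow> E (p + (0, 1)) (tr M p (p + (0, 1)) x) = tr M p (p + (0, 1)) (E p x)"
    and pq: "p \<le> q" and x: "x \<in> sp M p"
  shows "E q (tr M p q x) = tr M p q (E p x)"
proof -
  define N where "N p q \<longleftrightarrow> p \<le> q \<and> (\<forall>x \<in> sp M p. E q (tr M p q x) = tr M p q (E p x))" for p q
  have refl: "N p p" for p
    using persistence_moduleD(5)[OF M] E by (simp add: N_def)
  have trans: "N p r" if "N p q" "N q r" for p q r
    unfolding N_def
  proof (intro conjI ballI)
    have pq: "p \<le> q" "q \<le> r"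
      using that by (auto simp: N_def)
    then show "p \<le> r" by (rule order.trans)
    fix x assume x: "x \<in> sp M p"
    have "E r (tr M p r x) = E r (tr M q r (tr M p q x))"
      using persistence_moduleD(6)[OF M pq x] by simp
    also have "\<dots> = tr M q r (tr M p q (E p x))"
      using that x linear_betweenD(1)[OF persistence_moduleD(4)[OF M pq(1)] x] unfolding N_def by simp
    also have "\<dots> = tr M p r (E p x)"
      using persistence_moduleD(6)[OF M pq E[OF x]] .
    finally show "E r (tr M p r x) = tr M p r (E p x)" .
  qed
  have step: "p \<le> p + (1, 0)" "p \<le> p + (0, 1)" for p :: point
    by (cases p; simp)+
  have 1: "N p (p + (int k, 0))" for p k
  proof (induction k)
    case 0
    then show ?case using refl[of p] by (cases p) simp
  next
    case (Suc k)
    have "N (p + (int k, 0)) (p + (int k, 0) + (1, 0))"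
      unfolding N_def using adj(1) step(1) by blast
    from trans[OF Suc this] show ?case
      by (cases p) (simp add: add_ac)
  qed
  have 2: "N p (p + (0, int k))" for p k
  proof (induction k)
    case 0
    then show ?case using refl[of p] by (cases p) simp
  next
    case (Suc k)
    have "N (p + (0, int k)) (p + (0, int k) + (0, 1))"
      unfolding N_def using adj(2) step(2) by blast
    from trans[OF Suc this] show ?case
      by (cases p) (simp add: add_ac)
  qed
  have "q = p + (int (nat (fst q - fst p)), 0) + (0, int (nat (snd q - snd p)))"
    using pq by (cases p; cases q) simp
  then have "N p q"
    using trans[OF 1 2] by metis
  then show ?thesis
    using x by (simp add: N_def)
qed

text \<open>Each unit step stays within one of the four closed quadrants at \<open>(a, b)\<close>,
  so naturality can be checked quadrant by quadrant. The four pieces fit together because a corner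
  endomorphism is the identity on its lower axis and zero on its upper one.\<close>

lemma endomorphism_around_hole:
  fixes M :: "('k::field, 'v::ab_group_add) pmodule"
  assumes M: "persistence_module M" and fin: "finite (supp M)" and v: "(a, b) \<notin> supp M"
    and few: "card (supp M \<inter> {(x, y). x < a \<and> y > b}) \<le> 3"
      "card (supp M \<inter> {(x, y). x > a \<and> y < b}) \<le> 3"
  obtains E where "\<And>p. linear_between (scl M) (scl M) (sp M p) (sp M p) (E p)"
    and "\<And>p q x. p \<le> q \<Longrightarrow> x \<in> sp M p \<Longrightarrow> E q (tr M p q x) = tr M p q (E p x)"
    and "\<And>p x. p \<le> (a, b) \<Longrightarrow> x \<in> sp M p \<Longrightarrow> E p x = x"
    and "\<And>p x. (a, b) \<le> p \<Longrightarrow> x \<in> sp M p \<Longrightarrow> E p x = 0"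
proof -
  interpret ambient_space "scl M"
    using persistence_moduleD(1)[OF M] by (rule ambient_space.intro)
  note sub = persistence_moduleD(2)[OF M] and lin = persistence_moduleD(4)[OF M]
  \<comment> \<open>In both grids the first index counts steps down from \<open>(a, b)\<close> and
    the second steps up; \<open>Q\<close> has the coordinates of the plane interchanged, so that one
    lemma serves both quadrants.\<close>
  define P where "P i j = (a - int i, b + int j)" for i j
  define Q where "Q i j = (a + int j, b - int i)" for i j
  have "{P i j | i j. i > 0 \<and> j > 0} \<subseteq> {(x, y). x < a \<and> y > b}"
    "{Q i j | i j. i > 0 \<and> j > 0} \<subseteq> {(x, y). x > a \<and> y < b}"
    by (auto simp: P_def Q_def)
  then have card: "card (supp M \<inter> {P i j | i j. i > 0 \<and> j > 0}) \<le> 3"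
    "card (supp M \<inter> {Q i j | i j. i > 0 \<and> j > 0}) \<le> 3"
    using few fin by (meson Int_mono card_mono finite_Int order.refl order.trans)+
  have P: "P 0 0 \<notin> supp M" "\<And>i j. P i j \<le> P i (Suc j)" "\<And>i j. P (Suc i) j \<le> P i j"
    "\<And>i j i' j'. P i j = P i' j' \<Longrightarrow> i = i' \<and> j = j'"
    and Q: "Q 0 0 \<notin> supp M" "\<And>i j. Q i j \<le> Q i (Suc j)" "\<And>i j. Q (Suc i) j \<le> Q i j"
    "\<And>i j i' j'. Q i j = Q i' j' \<Longrightarrow> i = i' \<and> j = j'"
    using v by (auto simp: P_def Q_def)
  obtain e where e: "\<And>i j. lin (sp M (P i j)) (sp M (P i j)) (e i j)"
    "\<And>i j x. x \<in> sp M (P i j) \<Longrightarrow>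
      e i (Suc j) (tr M (P i j) (P i (Suc j)) x) = tr M (P i j) (P i (Suc j)) (e i j x)"
    "\<And>i j x. x \<in> sp M (P (Suc i) j) \<Longrightarrow>
      e i j (tr M (P (Suc i) j) (P i j) x) = tr M (P (Suc i) j) (P i j) (e (Suc i) j x)"
    "\<And>i x. e i 0 x = x"
    "\<And>j x. x \<in> sp M (P 0 j) \<Longrightarrow> e 0 j x = 0"
    by (rule corner_of_module[OF M fin P card(1)]) (assumption, rule that)
  obtain d where d: "\<And>i j. lin (sp M (Q i j)) (sp M (Q i j)) (d i j)"
    "\<And>i j x. x \<in> sp M (Q i j) \<Longrightarrow>
      d i (Suc j) (tr M (Q i j) (Q i (Suc j)) x) = tr M (Q i j) (Q i (Suc j)) (d i j x)"
    "\<And>i j x. x \<in> sp M (Q (Suc i) j) \<Longrightarrow>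
      d i j (tr M (Q (Suc i) j) (Q i j) x) = tr M (Q (Suc i) j) (Q i j) (d (Suc i) j x)"
    "\<And>i x. d i 0 x = x"
    "\<And>j x. x \<in> sp M (Q 0 j) \<Longrightarrow> d 0 j x = 0"
    by (rule corner_of_module[OF M fin Q card(2)]) (assumption, rule that)
  define E where "E p = (if fst p \<le> a
      then if snd p \<le> b then (\<lambda>x. x) else e (nat (a - fst p)) (nat (snd p - b))
      else if snd p \<ge> b then (\<lambda>x. 0) else d (nat (b - snd p)) (nat (fst p - a)))" for p
  have E_P: "E (P i j) x = e i j x" for i j x
    by (cases "j = 0") (simp_all add: E_def P_def e(4))
  \<comment> \<open>Unlike \<open>E_P\<close>, this holds only on the space: on the axis above the
    hole \<open>E\<close> is the constant zero, while \<open>d\<close> is known to vanish only on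
    elements of the module.\<close>
  have E_Q: "E (Q i j) x = d i j x" if "x \<in> sp M (Q i j)" for i j x
  proof (cases "j > 0 \<and> i = 0")
    case True
    then have "E (Q i j) x = 0"
      by (simp add: E_def Q_def)
    with True d(5) that show ?thesis by simp
  next
    case False
    then show ?thesis
      by (cases "j = 0") (simp_all add: E_def Q_def d(4))
  qed
  have lower: "E p x = x" if "p \<le> (a, b)" for p x
    using that by (cases p) (simp add: E_def)
  have upper: "E p x = 0" if "(a, b) \<le> p" "x \<in> sp M p" for p x
  proof (cases "fst p = a")
    case True
    then have "p = P 0 (nat (snd p - b))"
      using that(1) by (cases p) (simp add: P_def)
    with E_P e(5) that(2) show ?thesis by metis
  qed (use that(1) in \<open>cases p; simp add: E_def\<close>)
  have inP: "\<exists>i j. p = P i j" if "fst p \<le> a" "snd p \<ge> b" for p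
    by (rule exI[of _ "nat (a - fst p)"], rule exI[of _ "nat (snd p - b)"])
      (use that in \<open>cases p; simp add: P_def\<close>)
  have inQ: "\<exists>i j. p = Q i j" if "fst p \<ge> a" "snd p \<le> b" for p
    by (rule exI[of _ "nat (b - snd p)"], rule exI[of _ "nat (fst p - a)"])
      (use that in \<open>cases p; simp add: Q_def\<close>)
  have E_lin: "lin (sp M p) (sp M p) (E p)" for p
  proof -
    consider "p \<le> (a, b)" | "(a, b) \<le> p" | "fst p \<le> a" "snd p \<ge> b" | "fst p \<ge> a" "snd p \<le> b"
      by (cases p) force
    then show ?thesis
    proof cases
      case 1
      then show ?thesis
        by (simp add: linear_between_def lower)
    next
      case 2
      then show ?thesis
        using upper[OF 2] subspace_add[OF sub] subspace_scale[OF sub] subspace_0[OF sub]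
        by (simp add: linear_between_def)
    next
      case 3
      then obtain i j where "p = P i j"
        using inP by blast
      then show ?thesis
        using e(1)[of i j] by (simp add: linear_between_def E_P)
    next
      case 4
      then obtain i j where p: "p = Q i j"
        using inQ by blast
      have "E p x = d i j x" if "x \<in> sp M p" for x
        using E_Q p that by simp
      then show ?thesis
        using d(1)[of i j] subspace_add[OF sub[of p]] subspace_scale[OF sub[of p]]
        unfolding linear_between_def p by simp
    qed
  qed
  have tr0: "tr M p q 0 = 0" if "p \<le> q" for p q
    by (rule lin_zero[OF sub lin[OF that]])
  have adj1: "E (p + (1, 0)) (tr M p (p + (1, 0)) x) = tr M p (p + (1, 0)) (E p x)"
    if x: "x \<in> sp M p" for p x
  proof -
    have le: "p \<le> p + (1, 0)"
      by (cases p) simp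
    note tx = linear_betweenD(1)[OF lin[OF le] x]
    consider "p + (1, 0) \<le> (a, b)" | "(a, b) \<le> p" | "fst p < a" "snd p > b" | "fst p \<ge> a" "snd p < b"
      by (cases p) force
    then show ?thesis
    proof cases
      case 1
      then show ?thesis
        using lower le order.trans by metis
    next
      case 2
      then have "(a, b) \<le> p + (1, 0)"
        using le order.trans by blast
      then show ?thesis
        using upper[OF 2 x] upper[OF _ tx] tr0[OF le] by simp
    next
      case 3
      define i j where "i = nat (a - fst p - 1)" and "j = nat (snd p - b)"
      have "p = P (Suc i) j" "p + (1, 0) = P i j"
        using 3 by (cases p; simp add: P_def i_def j_def)+
      then show ?thesis
        using e(3) x E_P by metis
    next
      case 4
      define i j where "i = nat (b - snd p)" and "j = nat (fst p - a)"
      have "p = Q i j" "p + (1, 0) = Q i (Suc j)"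
        using 4 by (cases p; simp add: Q_def i_def j_def)+
      then show ?thesis
        using d(2) x tx E_Q by metis
    qed
  qed
  have adj2: "E (p + (0, 1)) (tr M p (p + (0, 1)) x) = tr M p (p + (0, 1)) (E p x)"
    if x: "x \<in> sp M p" for p x
  proof -
    have le: "p \<le> p + (0, 1)"
      by (cases p) simp
    note tx = linear_betweenD(1)[OF lin[OF le] x]
    consider "p + (0, 1) \<le> (a, b)" | "(a, b) \<le> p" | "fst p \<le> a" "snd p \<ge> b" | "fst p > a" "snd p < b"
      by (cases p) force
    then show ?thesis
    proof cases
      case 1
      then show ?thesis
        using lower le order.trans by metis
    next
      case 2
      then have "(a, b) \<le> p + (0, 1)"
        using le order.trans by blast
      then show ?thesis
        using upper[OF 2 x] upper[OF _ tx] tr0[OF le] by simp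
    next
      case 3
      define i j where "i = nat (a - fst p)" and "j = nat (snd p - b)"
      have "p = P i j" "p + (0, 1) = P i (Suc j)"
        using 3 by (cases p; simp add: P_def i_def j_def)+
      then show ?thesis
        using e(2) x E_P by metis
    next
      case 4
      define i j where "i = nat (b - snd p - 1)" and "j = nat (fst p - a)"
      have "p = Q (Suc i) j" "p + (0, 1) = Q i j"
        using 4 by (cases p; simp add: Q_def i_def j_def)+
      then show ?thesis
        using d(3) x tx E_Q by metis
    qed
  qed
  show thesis
  proof (rule that[of E])
    show "E q (tr M p q x) = tr M p q (E p x)" if "p \<le> q" "x \<in> sp M p" for p q x
      using natural_of_adjacent[OF M linear_betweenD(1)[OF E_lin] adj1 adj2 that] .
  qed (use E_lin lower upper in auto)
qed

section \<open>Holes of finite supports\<close>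

text \<open>Each grid edge borders two unit squares, which orient it oppositely; hence the
  differences of two coefficients.\<close>

lemma lookup_boundary2:
  "Poly_Mapping.lookup (boundary2 c) (p, q) =
     (if q = p + (1, 0) then Poly_Mapping.lookup c p - Poly_Mapping.lookup c (p - (0, 1)) else 0)
     + (if q = p + (0, 1) then Poly_Mapping.lookup c (p - (1, 0)) - Poly_Mapping.lookup c p else 0)"
proof -
  let ?l = "Poly_Mapping.lookup c" and ?K = "Poly_Mapping.keys c"
  have delta: "(\<Sum>r\<in>?K. if r = s \<and> b then ?l r else 0) = (if b then ?l s else 0)" for s b
    by (cases b) (simp_all add: sum.delta in_keys_iff)
  have edge: "(r, r + (1, 0)) = (p, q) \<longleftrightarrow> r = p \<and> q = p + (1, 0)"
    "(r + (1, 0), r + (1, 1)) = (p, q) \<longleftrightarrow> r = p - (1, 0) \<and> q = p + (0, 1)"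
    "(r + (0, 1), r + (1, 1)) = (p, q) \<longleftrightarrow> r = p - (0, 1) \<and> q = p + (1, 0)"
    "(r, r + (0, 1)) = (p, q) \<longleftrightarrow> r = p \<and> q = p + (0, 1)" for r
    by (cases r; cases p; cases q; force)+
  have "Poly_Mapping.lookup (boundary2 c) (p, q) =
      (\<Sum>r\<in>?K. if r = p \<and> q = p + (1, 0) then ?l r else 0)
      + (\<Sum>r\<in>?K. if r = p - (1, 0) \<and> q = p + (0, 1) then ?l r else 0)
      - (\<Sum>r\<in>?K. if r = p - (0, 1) \<and> q = p + (1, 0) then ?l r else 0)
      - (\<Sum>r\<in>?K. if r = p \<and> q = p + (0, 1) then ?l r else 0)"
    unfolding boundary2_def lookup_sum sum.distrib[symmetric] sum_subtractf[symmetric]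
    by (simp only: lookup_add lookup_minus lookup_single when_def edge)
  then show ?thesis
    by (simp add: delta)
qed

text \<open>Keys off the grid edges would add further terms; the hypothesis confines those at
  \<open>v\<close> to its four incident edges.\<close>

lemma lookup_boundary1:
  assumes "Poly_Mapping.keys z \<subseteq> cc_edges S"
  shows "Poly_Mapping.lookup (boundary1 z) v =
    Poly_Mapping.lookup z (v - (1, 0), v) + Poly_Mapping.lookup z (v - (0, 1), v)
    - Poly_Mapping.lookup z (v, v + (1, 0)) - Poly_Mapping.lookup z (v, v + (0, 1))"
proof -
  let ?l = "Poly_Mapping.lookup z" and ?K = "Poly_Mapping.keys z"
  have fin: "finite ?K" by simp
  have "Poly_Mapping.lookup (boundary1 z) v =
      (\<Sum>k\<in>?K. if snd k = v then ?l k else 0) - (\<Sum>k\<in>?K. if fst k = v then ?l k else 0)"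
    unfolding boundary1_def lookup_sum sum_subtractf[symmetric]
    by (intro sum.cong refl) (auto simp: lookup_minus lookup_single when_def)
  also have "(\<Sum>k\<in>?K. if snd k = v then ?l k else 0) = (\<Sum>k\<in>{(v - (1, 0), v), (v - (0, 1), v)}. ?l k)"
    unfolding sum.inter_filter[OF fin, symmetric]
  proof (rule sum.mono_neutral_left)
    show "{k \<in> ?K. snd k = v} \<subseteq> {(v - (1, 0), v), (v - (0, 1), v)}"
      using assms by (fastforce simp: cc_edges_def)
  qed (auto simp: in_keys_iff)
  also have "(\<Sum>k\<in>?K. if fst k = v then ?l k else 0) = (\<Sum>k\<in>{(v, v + (1, 0)), (v, v + (0, 1))}. ?l k)"
    unfolding sum.inter_filter[OF fin, symmetric]
  proof (rule sum.mono_neutral_left)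
    show "{k \<in> ?K. fst k = v} \<subseteq> {(v, v + (1, 0)), (v, v + (0, 1))}"
      using assms by (fastforce simp: cc_edges_def)
  qed (auto simp: in_keys_iff)
  finally show ?thesis
    by (cases v) simp
qed

lemma boundary1_boundary2:
  assumes "Poly_Mapping.keys (boundary2 c) \<subseteq> cc_edges S"
  shows "boundary1 (boundary2 c) = 0"
proof (rule poly_mapping_eqI)
  fix v
  show "Poly_Mapping.lookup (boundary1 (boundary2 c)) v = Poly_Mapping.lookup 0 v"
    unfolding lookup_boundary1[OF assms] by (cases v) (simp add: lookup_boundary2)
qed

lemma boundaries1_subset_cycles1:
  "(boundaries1 S :: ((point \<times> point) \<Rightarrow>\<^sub>0 'k::field) set) \<subseteq> cycles1 S"
proof
  fix z :: "(point \<times> point) \<Rightarrow>\<^sub>0 'k" assume "z \<in> boundaries1 S"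
  then obtain c where c: "Poly_Mapping.keys c \<subseteq> cc_squares S" "z = boundary2 c"
    by (auto simp: boundaries1_def)
  have l: "Poly_Mapping.lookup c (i, j) = 0" if "(i, j) \<notin> cc_squares S" for i j
    using c(1) that by (metis in_keys_iff subsetD)
  have "Poly_Mapping.lookup z (p, q) = 0" if "(p, q) \<notin> cc_edges S" for p q
  proof -
    obtain i j where p: "p = (i, j)" by (cases p)
    show ?thesis
      using that l[of i j] l[of i "j - 1"] l[of "i - 1" j]
      by (auto simp: c(2) lookup_boundary2 p cc_edges_def cc_squares_def)
  qed
  then have z: "Poly_Mapping.keys z \<subseteq> cc_edges S"
    unfolding subset_iff in_keys_iff by (metis surj_pair)
  then have "boundary1 z = 0"
    unfolding c(2) by (rule boundary1_boundary2)
  with z show "z \<in> cycles1 S"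
    by (simp add: cycles1_def)
qed

lemma boundaries1_diff:
  assumes "z \<in> boundaries1 S" and "z' \<in> boundaries1 S"
  shows "z - z' \<in> boundaries1 S"
proof -
  obtain c c' where c: "Poly_Mapping.keys c \<subseteq> cc_squares S" "z = boundary2 c"
      "Poly_Mapping.keys c' \<subseteq> cc_squares S" "z' = boundary2 c'"
    using assms by (auto simp: boundaries1_def)
  have "z - z' = boundary2 (c - c')"
    by (rule poly_mapping_eqI) (auto simp: c lookup_minus lookup_boundary2)
  moreover have "Poly_Mapping.keys (c - c') \<subseteq> cc_squares S"
    using c keys_diff[of c c'] by blast
  ultimately show ?thesis
    by (auto simp: boundaries1_def)
qed

lemma support_has_hole_iff:
  fixes M :: "('k::field, 'v::zero) pmodule"
  shows "support_has_hole M \<longleftrightarrow> \<not> (cycles1 (supp M) :: ((point \<times> point) \<Rightarrow>\<^sub>0 'k) set) \<subseteq> boundaries1 (supp M)"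
proof -
  let ?C = "cycles1 (supp M) :: ((point \<times> point) \<Rightarrow>\<^sub>0 'k) set" and ?B = "boundaries1 (supp M) :: ((point \<times> point) \<Rightarrow>\<^sub>0 'k) set"
  let ?r = "{(z, z'). z \<in> ?C \<and> z' \<in> ?C \<and> z - z' \<in> ?B}"
  have B0: "0 \<in> ?B"
  proof -
    have "boundary2 0 = (0 :: (point \<times> point) \<Rightarrow>\<^sub>0 'k)"
      by (simp add: boundary2_def)
    then show ?thesis
      unfolding boundaries1_def by (metis (mono_tags, lifting) empty_subsetI image_eqI keys_zero mem_Collect_eq)
  qed
  have "?C // ?r = {?B} \<longleftrightarrow> ?C \<subseteq> ?B"
  proof
    assume eq: "?C // ?r = {?B}"
    show "?C \<subseteq> ?B"
    proof
      fix z assume "z \<in> ?C"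
      then have "?r `` {z} = ?B"
        using eq quotientI[of z ?C ?r] by blast
      moreover have "z \<in> ?r `` {z}"
        using \<open>z \<in> ?C\<close> B0 by simp
      ultimately show "z \<in> ?B" by blast
    qed
  next
    assume "?C \<subseteq> ?B"
    then have C: "?C = ?B"
      using boundaries1_subset_cycles1 by blast
    have "?r `` {z} = ?B" if "z \<in> ?C" for z
      using that boundaries1_diff unfolding C by auto
    moreover have "0 \<in> ?C"
      using B0 C by simp
    ultimately show "?C // ?r = {?B}"
      unfolding quotient_def by blast
  qed
  then show ?thesis
    by (simp add: support_has_hole_def homology1_def)
qed

section \<open>Winding numbers and missing points\<close>

text \<open>The full plane grid has no first homology: a cycle is the boundary of its winding
  numbers. The squares of \<open>c\<close> may have corners outside \<open>S\<close>, and this is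
  what later detects a hole.\<close>

lemma cycle_bounds_in_plane:
  fixes z :: "(point \<times> point) \<Rightarrow>\<^sub>0 'k::field"
  assumes z: "z \<in> cycles1 S" and S: "finite S"
  obtains c where "z = boundary2 c"
proof -
  have keys: "Poly_Mapping.keys z \<subseteq> cc_edges S" and cyc: "boundary1 z = 0"
    using z by (auto simp: cycles1_def)
  define h g where "h i j = Poly_Mapping.lookup z ((i, j), (i + 1, j))"
    and "g i j = Poly_Mapping.lookup z ((i, j), (i, j + 1))" for i j :: int
  have cycle: "h (i - 1) j + g i (j - 1) = h i j + g i j" for i j
  proof -
    have "Poly_Mapping.lookup (boundary1 z) (i, j) = 0"
      using cyc by simp
    then show ?thesis
      unfolding lookup_boundary1[OF keys] by (simp add: h_def g_def diff_diff_eq)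
  qed
  \<comment> \<open>\<open>S\<close> lies in the box of radius \<open>N\<close>; 0 is inserted so
    that the maximum also exists for empty \<open>S\<close>.\<close>
  define N where "N = Max (insert 0 (abs ` (fst ` S \<union> snd ` S)))"
  have N0: "\<bar>i\<bar> \<le> N \<and> \<bar>j\<bar> \<le> N" if "(i, j) \<in> S" for i j
  proof -
    have "i \<in> fst ` S \<union> snd ` S" "j \<in> fst ` S \<union> snd ` S"
      using that by force+
    then show ?thesis
      unfolding N_def using S by (intro conjI Max_ge) auto
  qed
  have N: "h i j = 0 \<and> g i j = 0" if "\<bar>i\<bar> > N \<or> \<bar>j\<bar> > N" for i j
  proof -
    have "(i, j) \<notin> S"
      using N0[of i j] that by auto
    then have "((i, j), q) \<notin> Poly_Mapping.keys z" for q
      using keys by (auto simp: cc_edges_def)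
    then show ?thesis
      by (simp add: h_def g_def in_keys_iff)
  qed
  \<comment> \<open>The winding number around a square, counted on the ray of decreasing second coordinate.\<close>
  define w where "w i j = (\<Sum>k\<in>{-N..j}. h i k)" for i j
  have w1: "w i j - w i (j - 1) = h i j" for i j
  proof (cases "j \<ge> -N")
    case True
    then have "{-N..j} = insert j {-N..j - 1}" by auto
    then show ?thesis
      by (simp add: w_def)
  next
    case False
    then have "N < \<bar>i\<bar> \<or> N < \<bar>j\<bar>"
      by auto
    with False show ?thesis
      using N[of i j] by (simp add: w_def)
  qed
  have low: "w i j = 0" if "j < -N" for i j
    using that by (simp add: w_def)
  \<comment> \<open>The cycle condition at \<open>(i, j + 1)\<close> carries the equation from
    \<open>j\<close> to \<open>j + 1\<close>, starting just below the box, where both sides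
    vanish.\<close>
  have w2: "w (i - 1) j - w i j = g i j" for i j
  proof (cases "j \<ge> -N - 1")
    case True
    then show ?thesis
    proof (induction j rule: int_ge_induct)
      case base
      have "N < \<bar>- N - 1\<bar>"
        by linarith
      then show ?case
        using low N[of i "-N-1"] by simp
    next
      case (step j)
      show ?case
        using step.IH w1[of i "j + 1"] w1[of "i - 1" "j + 1"] cycle[of i "j + 1"]
        by (simp add: algebra_simps)
    qed
  next
    case False
    then have "N < \<bar>j\<bar>"
      by linarith
    with False show ?thesis
      using low N[of i j] by simp
  qed
  have out_i: "w i j = 0" if "\<bar>i\<bar> > N" for i j
    using N that by (simp add: w_def)
  \<comment> \<open>Above the box the sum need not vanish term by term. But \<open>g\<close> is zero
    there, so \<open>w\<close> does not change with \<open>i\<close>, and it is zero for remote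
    \<open>i\<close>. This makes \<open>w\<close> finitely supported.\<close>
  have high: "w i j = 0" if "j > N" for i j
  proof (cases "i \<ge> -N - 1")
    case True
    then show ?thesis
    proof (induction i rule: int_ge_induct)
      case base
      then show ?case
        by (rule out_i) auto
    next
      case (step i)
      have "N < \<bar>j\<bar>"
        using that by linarith
      with step show ?case
        using w2[of "i + 1" j] N[of "i + 1" j] that by simp
    qed
  next
    case False
    then show ?thesis
      by (intro out_i) auto
  qed
  have "finite {p. (case p of (i, j) \<Rightarrow> w i j) \<noteq> 0}"
  proof (rule finite_subset)
    show "{p. (case p of (i, j) \<Rightarrow> w i j) \<noteq> 0} \<subseteq> {-N..N} \<times> {-N..N}"
      using out_i low high by (force simp: abs_le_iff not_less[symmetric])
  qed simp
  then have lw: "Poly_Mapping.lookup (Abs_poly_mapping (\<lambda>(i, j). w i j)) (i, j) = w i j" for i j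
    by (simp add: lookup_Abs_poly_mapping)
  have "z = boundary2 (Abs_poly_mapping (\<lambda>(i, j). w i j))"
  proof (rule poly_mapping_eqI)
    fix pq :: "point \<times> point"
    obtain i j q where pq: "pq = ((i, j), q)"
      by (metis surj_pair)
    have "Poly_Mapping.lookup z ((i, j), q) = 0" if "q \<noteq> (i + 1, j)" "q \<noteq> (i, j + 1)"
    proof -
      have "((i, j), q) \<notin> Poly_Mapping.keys z"
        using keys that by (auto simp: cc_edges_def)
      then show ?thesis
        by (simp add: in_keys_iff)
    qed
    then show "Poly_Mapping.lookup z pq = Poly_Mapping.lookup (boundary2 (Abs_poly_mapping (\<lambda>(i, j). w i j))) pq"
      unfolding pq lookup_boundary2 using w1[of i j] w2[of i j]
      by (auto simp: lw h_def g_def)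
  qed
  with that show thesis .
qed

text \<open>If every square of nonzero coefficient had all its corners in the support, the cycle
  would bound there; so some such square has a missing corner. King-move neighbours are corners of a
  common square and hence share their winding number if both are missing.\<close>

lemma hole_encloses:
  fixes M :: "('k::field, 'v::zero) pmodule"
  assumes hole: "support_has_hole M" and S: "finite (supp M)"
  obtains T where "finite T" and "T \<noteq> {}" and "T \<inter> supp M = {}"
    and "\<And>i j i' j'. (i, j) \<in> T \<Longrightarrow> \<bar>i' - i\<bar> \<le> 1 \<Longrightarrow> \<bar>j' - j\<bar> \<le> 1 \<Longrightarrow> (i', j') \<in> T \<union> supp M"
proof -
  obtain z :: "(point \<times> point) \<Rightarrow>\<^sub>0 'k" where z: "z \<in> cycles1 (supp M)" "z \<notin> boundaries1 (supp M)"
    using hole by (auto simp: support_has_hole_iff)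
  obtain c where c: "z = boundary2 c"
    by (rule cycle_bounds_in_plane[OF z(1) S])
  define w where "w i j = Poly_Mapping.lookup c (i, j)" for i j :: int
  have z0: "Poly_Mapping.lookup z (p, q) = 0" if "p \<notin> supp M \<or> q \<notin> supp M" for p q
  proof -
    have "(p, q) \<notin> Poly_Mapping.keys z"
      using z(1) that by (auto simp: cycles1_def cc_edges_def)
    then show ?thesis
      by (simp add: in_keys_iff)
  qed
  \<comment> \<open>No edge of the support meets a missing point, so the four squares around it have equal coefficients.\<close>
  have const: "w i (j - 1) = w i j \<and> w (i - 1) j = w i j \<and> w (i - 1) (j - 1) = w i j"
    if v: "(i, j) \<notin> supp M" for i j
  proof -
    have "Poly_Mapping.lookup z ((i, j), (i + 1, j)) = w i j - w i (j - 1)"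
      "Poly_Mapping.lookup z ((i, j), (i, j + 1)) = w (i - 1) j - w i j"
      "Poly_Mapping.lookup z ((i - 1, j), (i, j)) = w (i - 1) j - w (i - 1) (j - 1)"
      by (simp_all add: c lookup_boundary2 w_def)
    then show ?thesis
      using z0 v by auto
  qed
  define T where "T = {(i, j). (i, j) \<notin> supp M \<and> w i j \<noteq> 0}"
  have "T \<subseteq> Poly_Mapping.keys c"
    by (auto simp: T_def w_def in_keys_iff)
  then have "finite T"
    by (rule finite_subset) simp
  moreover have "T \<noteq> {}"
  proof -
    have "\<not> Poly_Mapping.keys c \<subseteq> cc_squares (supp M)"
      using z(2) c by (auto simp: boundaries1_def)
    then obtain i j where ij: "w i j \<noteq> 0" "(i, j) \<notin> cc_squares (supp M)"
      by (auto simp: w_def in_keys_iff)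
    then consider "(i, j) \<notin> supp M" | "(i, j + 1) \<notin> supp M" | "(i + 1, j + 1) \<notin> supp M" | "(i + 1, j) \<notin> supp M"
      by (auto simp: cc_squares_def)
    then show ?thesis
    proof cases
      case 1
      then show ?thesis using ij by (auto simp: T_def)
    next
      case 2
      then show ?thesis using ij const[OF 2] by (auto simp: T_def)
    next
      case 3
      then show ?thesis using ij const[OF 3] by (auto simp: T_def)
    next
      case 4
      then show ?thesis using ij const[OF 4] by (auto simp: T_def)
    qed
  qed
  moreover have "T \<inter> supp M = {}"
    by (auto simp: T_def)
  moreover have "(i', j') \<in> T \<union> supp M" if T: "(i, j) \<in> T" and d: "\<bar>i' - i\<bar> \<le> 1" "\<bar>j' - j\<bar> \<le> 1" for i j i' j'
  proof (cases "(i', j') \<in> supp M")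
    case False
    have v: "(i, j) \<notin> supp M" "w i j \<noteq> 0"
      using T by (auto simp: T_def)
    have "i' = i \<or> i' = i + 1 \<or> i' = i - 1" "j' = j \<or> j' = j + 1 \<or> j' = j - 1"
      using d by auto
    then have "w i' j' = w i j"
      using const[OF v(1)] const[OF False] by auto
    then show ?thesis
      using v False by (simp add: T_def)
  qed simp
  ultimately show thesis
    by (rule that)
qed

section \<open>Counting support points around a missing point\<close>

text \<open>A point of \<open>T\<close> farthest out in direction \<open>(s, t)\<close> within the
  closed quadrant has its three outward neighbours in that quadrant too. Being farther out, they are
  not in \<open>T\<close>, so they belong to \<open>S\<close>. The signs treat all four quadrants at
  once.\<close>

lemma quadrant_corner:
  fixes T S :: "point set" and s t :: int
  assumes T: "finite T" "(a, b) \<in> T"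
    and closed: "\<forall>i j i' j'. (i, j) \<in> T \<longrightarrow> \<bar>i' - i\<bar> \<le> 1 \<longrightarrow> \<bar>j' - j\<bar> \<le> 1 \<longrightarrow> (i', j') \<in> T \<union> S"
    and st: "\<bar>s\<bar> = 1" "\<bar>t\<bar> = 1"
  obtains i j where "s * (i - a) \<ge> 0" and "t * (j - b) \<ge> 0"
    and "(i + s, j) \<in> S" and "(i, j + t) \<in> S" and "(i + s, j + t) \<in> S"
proof -
  define A where "A = {p \<in> T. s * (fst p - a) \<ge> 0 \<and> t * (snd p - b) \<ge> 0}"
  \<comment> \<open>Negated, so that the minimum is attained farthest out.\<close>
  define f where "f p = - (s * fst p + t * snd p)" for p :: point
  have "(a, b) \<in> A"
    using T(2) by (simp add: A_def)
  then have A: "finite A" "A \<noteq> {}"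
    using T(1) by (simp add: A_def, blast)
  obtain i j where ij: "(i, j) \<in> A" "\<And>p. p \<in> A \<Longrightarrow> f (i, j) \<le> f p"
    using arg_min_if_finite[OF A, of f] by (metis not_less surj_pair)
  have q: "(i, j) \<in> T" "s * (i - a) \<ge> 0" "t * (j - b) \<ge> 0"
    using ij(1) by (auto simp: A_def)
  have s: "s = 1 \<or> s = -1" and t: "t = 1 \<or> t = -1"
    using st by auto
  have "(i + s, j) \<notin> T" "(i, j + t) \<notin> T" "(i + s, j + t) \<notin> T"
    using ij(2)[of "(i + s, j)"] ij(2)[of "(i, j + t)"] ij(2)[of "(i + s, j + t)"] q s t
    by (auto simp: A_def f_def)
  moreover have "(i + s, j) \<in> T \<union> S" "(i, j + t) \<in> T \<union> S" "(i + s, j + t) \<in> T \<union> S"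
    using closed[rule_format, OF q(1), of "i + s" j] closed[rule_format, OF q(1), of i "j + t"]
      closed[rule_format, OF q(1), of "i + s" "j + t"] st
    by simp_all
  ultimately show thesis
    using q that by blast
qed

text \<open>The 7 is 3 + 3 + 1. Each comparable quadrant keeps all three outward neighbours, whereas
  for an incomparable one only the diagonal neighbour is sure to lie in the open quadrant: the other
  two may be on an axis, which is counted with the comparable quadrants.\<close>

lemma enclosed_point_counts:
  fixes T S :: "point set"
  assumes S: "finite S" and T: "finite T" "(a, b) \<in> T" "T \<inter> S = {}"
    and closed: "\<forall>i j i' j'. (i, j) \<in> T \<longrightarrow> \<bar>i' - i\<bar> \<le> 1 \<longrightarrow> \<bar>j' - j\<bar> \<le> 1 \<longrightarrow> (i', j') \<in> T \<union> S"
  shows "\<exists>p \<in> S. p \<le> (a, b)" and "\<exists>p \<in> S. (a, b) \<le> p"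
    and "7 + card (S \<inter> {(x, y). x < a \<and> y > b}) \<le> card S"
    and "7 + card (S \<inter> {(x, y). x > a \<and> y < b}) \<le> card S"
proof -
  define L U where "L = S \<inter> {p. p \<le> (a, b)}" and "U = S \<inter> {p. (a, b) \<le> p}"
  define Q R where "Q = S \<inter> {(x, y). x < a \<and> y > b}" and "R = S \<inter> {(x, y). x > a \<and> y < b}"
  have fin: "finite L" "finite U" "finite Q" "finite R"
    using S by (auto simp: L_def U_def Q_def R_def)
  have L: "3 \<le> card L"
  proof -
    obtain i j where ij: "- 1 * (i - a) \<ge> 0" "- 1 * (j - b) \<ge> 0"
      "(i + - 1, j) \<in> S" "(i, j + - 1) \<in> S" "(i + - 1, j + - 1) \<in> S"
      by (rule quadrant_corner[OF T(1,2) closed, where s = "- 1" and t = "- 1"]) auto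
    have "card {(i + - 1, j), (i, j + - 1), (i + - 1, j + - 1)} \<le> card L"
      by (rule card_mono[OF fin(1)]) (use ij in \<open>auto simp: L_def\<close>)
    then show ?thesis by simp
  qed
  have U: "3 \<le> card U"
  proof -
    obtain i j where ij: "1 * (i - a) \<ge> 0" "1 * (j - b) \<ge> 0"
      "(i + 1, j) \<in> S" "(i, j + 1) \<in> S" "(i + 1, j + 1) \<in> S"
      by (rule quadrant_corner[OF T(1,2) closed, where s = 1 and t = 1]) auto
    have "card {(i + 1, j), (i, j + 1), (i + 1, j + 1)} \<le> card U"
      by (rule card_mono[OF fin(2)]) (use ij in \<open>auto simp: U_def\<close>)
    then show ?thesis by simp
  qed
  have Q: "1 \<le> card Q"
  proof -
    obtain i j where ij: "- 1 * (i - a) \<ge> 0" "1 * (j - b) \<ge> 0" "(i + - 1, j + 1) \<in> S"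
      by (rule quadrant_corner[OF T(1,2) closed, where s = "- 1" and t = 1]) auto
    then have "(i + - 1, j + 1) \<in> Q"
      by (auto simp: Q_def)
    then show ?thesis
      using fin(3) card_gt_0_iff[of Q] by (auto simp: Suc_le_eq)
  qed
  have R: "1 \<le> card R"
  proof -
    obtain i j where ij: "1 * (i - a) \<ge> 0" "- 1 * (j - b) \<ge> 0" "(i + 1, j + - 1) \<in> S"
      by (rule quadrant_corner[OF T(1,2) closed, where s = 1 and t = "- 1"]) auto
    then have "(i + 1, j + - 1) \<in> R"
      by (auto simp: R_def)
    then show ?thesis
      using fin(4) card_gt_0_iff[of R] by (auto simp: Suc_le_eq)
  qed
  have v: "(a, b) \<notin> S"
    using T by blast
  have disj: "L \<inter> U = {}" "(L \<union> U) \<inter> Q = {}" "(L \<union> U \<union> Q) \<inter> R = {}"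
    using v by (auto simp: L_def U_def Q_def R_def dest: order.antisym)
  have "card L + card U + card Q + card R = card (L \<union> U \<union> Q \<union> R)"
    using fin disj by (simp add: card_Un_disjoint)
  also have "\<dots> \<le> card S"
    by (rule card_mono[OF S]) (auto simp: L_def U_def Q_def R_def)
  finally have sum: "card L + card U + card Q + card R \<le> card S" .
  show "7 + card (S \<inter> {(x, y). x < a \<and> y > b}) \<le> card S"
    "7 + card (S \<inter> {(x, y). x > a \<and> y < b}) \<le> card S"
    using sum L U Q R unfolding Q_def[symmetric] R_def[symmetric] by linarith+
  have "L \<noteq> {}" "U \<noteq> {}"
    using L U by auto
  then show "\<exists>p \<in> S. p \<le> (a, b)" "\<exists>p \<in> S. (a, b) \<le> p"
    unfolding L_def U_def by blast+
qed

lemma indecomposable_hole_card: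
  fixes M :: "('k::field, 'v::ab_group_add) pmodule"
  assumes M: "indecomposable M" and hole: "support_has_hole M" and fin: "finite (supp M)"
  shows "11 \<le> card (supp M)"
proof (rule ccontr)
  assume "\<not> 11 \<le> card (supp M)"
  then have small: "card (supp M) \<le> 10" by simp
  have pm: "persistence_module M"
    using M by (simp add: indecomposable_def)
  obtain T where T: "finite T" "T \<noteq> {}" "T \<inter> supp M = {}"
    "\<And>i j i' j'. (i, j) \<in> T \<Longrightarrow> \<bar>i' - i\<bar> \<le> 1 \<Longrightarrow> \<bar>j' - j\<bar> \<le> 1 \<Longrightarrow> (i', j') \<in> T \<union> supp M"
    by (rule hole_encloses[OF hole fin]) (rule that)
  then have closed: "\<forall>i j i' j'. (i, j) \<in> T \<longrightarrow> \<bar>i' - i\<bar> \<le> 1 \<longrightarrow> \<bar>j' - j\<bar> \<le> 1 \<longrightarrow> (i', j') \<in> T \<union> supp M"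
    by blast
  obtain a b where v: "(a, b) \<in> T"
    using T(2) by (metis ex_in_conv surj_pair)
  then have v': "(a, b) \<notin> supp M"
    using T(3) by blast
  note counts = enclosed_point_counts[OF fin T(1) v T(3) closed]
  obtain p q where pq: "p \<in> supp M" "p \<le> (a, b)" "q \<in> supp M" "(a, b) \<le> q"
    using counts(1,2) by blast
  have few: "card (supp M \<inter> {(x, y). x < a \<and> y > b}) \<le> 3" "card (supp M \<inter> {(x, y). x > a \<and> y < b}) \<le> 3"
    using counts(3,4) small by auto
  obtain E where E: "\<And>p. linear_between (scl M) (scl M) (sp M p) (sp M p) (E p)"
    "\<And>p q x. p \<le> q \<Longrightarrow> x \<in> sp M p \<Longrightarrow> E q (tr M p q x) = tr M p q (E p x)"
    "\<And>p x. p \<le> (a, b) \<Longrightarrow> x \<in> sp M p \<Longrightarrow> E p x = x"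
    "\<And>p x. (a, b) \<le> p \<Longrightarrow> x \<in> sp M p \<Longrightarrow> E p x = 0"
    by (rule endomorphism_around_hole[OF pm fin v' few]) (rule that)
  show False
    by (rule indecomposable_no_partial_endomorphism[OF M E(1,2) pq(1) E(3)[OF pq(2)] pq(3) E(4)[OF pq(4)]])
qed

section \<open>The example\<close>

text \<open>The projection onto \<open>W\<close>, transported to \<open>M\<close> through the
  isomorphism, is an idempotent endomorphism. It is zero only if \<open>W\<close> is zero, and the
  identity only if \<open>W'\<close> is zero.\<close>

lemma indecomposableI:
  fixes M :: "('k::field, 'v::ab_group_add) pmodule"
  assumes M: "persistence_module M" "\<not> zero_module M"
    and idem: "\<And>e. (\<And>p. linear_between (scl M) (scl M) (sp M p) (sp M p) (e p)) \<Longrightarrow>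
      (\<And>p q x. p \<le> q \<Longrightarrow> x \<in> sp M p \<Longrightarrow> e q (tr M p q x) = tr M p q (e p x)) \<Longrightarrow>
      (\<And>p x. x \<in> sp M p \<Longrightarrow> e p (e p x) = e p x) \<Longrightarrow>
      (\<forall>p. \<forall>x \<in> sp M p. e p x = 0) \<or> (\<forall>p. \<forall>x \<in> sp M p. e p x = x)"
  shows "indecomposable M"
  unfolding indecomposable_def
proof (intro conjI allI impI)
  fix W W' :: "('k, 'v) pmodule"
  assume "persistence_module W \<and> persistence_module W' \<and> isomorphic M (direct_sum W W')"
  then have W: "persistence_module W" and W': "persistence_module W'"
    and iso: "isomorphic M (direct_sum W W')" by auto
  interpret w: vector_space "scl W"
    using persistence_moduleD(1)[OF W] .
  interpret w': vector_space "scl W'"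
    using persistence_moduleD(1)[OF W'] .
  interpret wp: module_prod "scl W" "scl W'"
    by unfold_locales
  interpret m: ambient_space "scl M"
    using persistence_moduleD(1)[OF M(1)] by (rule ambient_space.intro)
  have sp_sum: "sp (direct_sum W W') p = sp W p \<times> sp W' p"
    and tr_sum: "tr (direct_sum W W') p q = map_prod (tr W p q) (tr W' p q)" for p q
    by (simp_all add: direct_sum_def)
  obtain \<phi> where \<phi>0: "\<forall>p. linear_between (scl M) (scl (direct_sum W W')) (sp M p) (sp W p \<times> sp W' p) (\<phi> p) \<and>
      bij_betw (\<phi> p) (sp M p) (sp W p \<times> sp W' p)"
    "\<forall>p q. p \<le> q \<longrightarrow> (\<forall>x\<in>sp M p. \<phi> q (tr M p q x) = map_prod (tr W p q) (tr W' p q) (\<phi> p x))"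
    using iso unfolding isomorphic_def sp_sum tr_sum by (elim exE conjE)
  then have \<phi>: "\<And>p. linear_between (scl M) (scl (direct_sum W W')) (sp M p) (sp W p \<times> sp W' p) (\<phi> p)"
    "\<And>p. bij_betw (\<phi> p) (sp M p) (sp W p \<times> sp W' p)"
    "\<And>p q x. p \<le> q \<Longrightarrow> x \<in> sp M p \<Longrightarrow> \<phi> q (tr M p q x) = map_prod (tr W p q) (tr W' p q) (\<phi> p x)"
    by blast+
  have scl: "scl (direct_sum W W') c (y, z) = (scl W c y, scl W' c z)" for c y z
    by (simp add: direct_sum_def wp.scale_prod)
  have zero: "0 \<in> sp W p" "0 \<in> sp W' p" for p
    using w.subspace_0[OF persistence_moduleD(2)[OF W]] w'.subspace_0[OF persistence_moduleD(2)[OF W']] .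
  define e where "e p x = the_inv_into (sp M p) (\<phi> p) (fst (\<phi> p x), 0)" for p x
  have e: "e p x \<in> sp M p" "\<phi> p (e p x) = (fst (\<phi> p x), 0)" if x: "x \<in> sp M p" for p x
  proof -
    have "\<phi> p x \<in> sp W p \<times> sp W' p"
      using linear_betweenD(1)[OF \<phi>(1) x] .
    then have mem: "(fst (\<phi> p x), 0) \<in> \<phi> p ` sp M p" and inj: "inj_on (\<phi> p) (sp M p)"
      using \<phi>(2)[of p] zero(2)[of p] by (simp_all add: bij_betw_def mem_Times_iff)
    show "e p x \<in> sp M p"
      unfolding e_def using the_inv_into_into[OF inj mem order.refl] .
    show "\<phi> p (e p x) = (fst (\<phi> p x), 0)"
      unfolding e_def using f_the_inv_into_f[OF inj mem] .
  qed
  have eqI: "x = y" if "x \<in> sp M p" "y \<in> sp M p" "\<phi> p x = \<phi> p y" for x y p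
    using \<phi>(2)[of p] that by (auto simp: bij_betw_def inj_on_def)
  note add = m.subspace_add[OF persistence_moduleD(2)[OF M(1)]]
    and scale = m.subspace_scale[OF persistence_moduleD(2)[OF M(1)]]
  have "(\<forall>p. \<forall>x \<in> sp M p. e p x = 0) \<or> (\<forall>p. \<forall>x \<in> sp M p. e p x = x)"
  proof (rule idem)
    show "linear_between (scl M) (scl M) (sp M p) (sp M p) (e p)" for p
      unfolding linear_between_def
    proof (intro conjI ballI allI)
      show "e p x \<in> sp M p" if "x \<in> sp M p" for x
        using e that by blast
      show "e p (x + y) = e p x + e p y" if "x \<in> sp M p" "y \<in> sp M p" for x y
        by (rule eqI[of _ p]) (use that add e linear_betweenD(2)[OF \<phi>(1)] in simp_all)
      show "e p (scl M c x) = scl M c (e p x)" if "x \<in> sp M p" for c x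
      proof (rule eqI[of _ p])
        have "\<phi> p (scl M c x) = (scl W c (fst (\<phi> p x)), scl W' c (snd (\<phi> p x)))"
          using linear_betweenD(3)[OF \<phi>(1) that, of c] scl by (metis prod.collapse)
        then show "\<phi> p (e p (scl M c x)) = \<phi> p (scl M c (e p x))"
          using that scale e linear_betweenD(3)[OF \<phi>(1)] by (simp add: scl)
      qed (use that scale e in simp_all)
    qed
    show "e q (tr M p q x) = tr M p q (e p x)" if "p \<le> q" "x \<in> sp M p" for p q x
    proof (rule eqI[of _ q])
      have t: "tr M p q y \<in> sp M q" if "y \<in> sp M p" for y
        using linear_betweenD(1)[OF persistence_moduleD(4)[OF M(1) \<open>p \<le> q\<close>] that] .
      show "e q (tr M p q x) \<in> sp M q" "tr M p q (e p x) \<in> sp M q"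
        using t e that by simp_all
      have "tr W' p q 0 = 0"
      proof -
        have "tr W' p q (0 + 0) = tr W' p q 0 + tr W' p q 0"
          using linear_betweenD(2)[OF persistence_moduleD(4)[OF W' that(1)]] zero by blast
        then show ?thesis by simp
      qed
      then show "\<phi> q (e q (tr M p q x)) = \<phi> q (tr M p q (e p x))"
        using that t e \<phi>(3) by simp
    qed
    show "e p (e p x) = e p x" if "x \<in> sp M p" for p x
      by (rule eqI[of _ p]) (use that e in simp_all)
  qed
  then show "zero_module W \<or> zero_module W'"
  proof
    assume z: "\<forall>p. \<forall>x \<in> sp M p. e p x = 0"
    have "y = 0" if y: "y \<in> sp W p" for p y
    proof -
      obtain x where x: "x \<in> sp M p" "\<phi> p x = (y, 0)"
        using \<phi>(2)[of p] y zero(2)[of p] by (force simp: bij_betw_def image_iff)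
      have "\<phi> p (0 + 0) = \<phi> p 0 + \<phi> p 0"
        by (rule linear_betweenD(2)[OF \<phi>(1)]) (use z e x in metis)+
      then have "\<phi> p 0 = 0" by simp
      then show ?thesis
        using e(2)[OF x(1)] z x by (simp add: zero_prod_def)
    qed
    then have "zero_module W"
      using zero(1) by (auto simp: zero_module_def)
    then show ?thesis ..
  next
    assume z: "\<forall>p. \<forall>x \<in> sp M p. e p x = x"
    have "y = 0" if y: "y \<in> sp W' p" for p y
    proof -
      obtain x where x: "x \<in> sp M p" "\<phi> p x = (0, y)"
        using \<phi>(2)[of p] y zero(1)[of p] by (force simp: bij_betw_def image_iff)
      then show ?thesis
        using e(2)[OF x(1)] z by simp
    qed
    then have "zero_module W'"
      using zero(2) by (auto simp: zero_module_def)
    then show ?thesis ..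
  qed
qed (use M in auto)

abbreviation scale2 :: "'k::field \<Rightarrow> 'k \<times> 'k \<Rightarrow> 'k \<times> 'k" where
  "scale2 \<equiv> module_prod.scale (*) (*)"

lemma vector_space_scale2: "vector_space (scale2 :: 'k::field \<Rightarrow> _)"
  and scale2_Pair: "scale2 c (x, y) = (c * x, c * (y :: 'k))"
proof -
  interpret vector_space "(*) :: 'k \<Rightarrow> 'k \<Rightarrow> 'k"
    by unfold_locales (auto simp: algebra_simps)
  interpret vector_space_prod "(*) :: 'k \<Rightarrow> 'k \<Rightarrow> 'k" "(*) :: 'k \<Rightarrow> 'k \<Rightarrow> 'k"
    by unfold_locales
  show "vector_space (scale2 :: 'k::field \<Rightarrow> _)"
    by (rule p.vector_space_axioms)
  show "scale2 c (x, y) = (c * x, c * y)"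
    by (rule scale_prod)
qed

definition ex_lines :: "point set" where
  "ex_lines = {(0,2), (0,3), (1,0), (1,1), (1,3), (2,0), (2,2), (3,0), (3,1), (3,2)}"

lemma example_moduleD:
  fixes E :: "('k::field, 'k \<times> 'k) pmodule"
  assumes "example_module E"
  shows "persistence_module E"
    and "scl E = scale2"
    and "sp E (1, 2) = UNIV"
    and "p \<in> ex_lines \<Longrightarrow> sp E p = UNIV \<times> {0}"
    and "p \<notin> insert (1, 2) ex_lines \<Longrightarrow> sp E p = {0}"
    and "tr E (1,1) (1,2) (x, 0) = (x, 0)"
    and "tr E (0,2) (1,2) (x, 0) = (x, x)"
    and "tr E (1,2) (1,3) (x, y) = (x, 0)"
    and "tr E (1,2) (2,2) (x, y) = (y, 0)"
    and "(p, q) \<in> {((1,0),(1,1)), ((0,2),(0,3)), ((0,3),(1,3)), ((1,0),(2,0)),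
                ((2,2),(3,2)), ((3,0),(3,1)), ((3,1),(3,2))} \<Longrightarrow> tr E p q (x, 0) = (x, 0)"
  using assms unfolding example_module_def Let_def ex_lines_def by (blast+)

lemma supp_example:
  fixes E :: "('k::field, 'k \<times> 'k) pmodule"
  assumes "example_module E"
  shows "supp E = insert (1, 2) ex_lines"
proof -
  have "(UNIV :: ('k \<times> 'k) set) \<noteq> {0}" "(UNIV \<times> {0} :: ('k \<times> 'k) set) \<noteq> {0}"
  proof -
    have "(1, 0) \<in> (UNIV :: ('k \<times> 'k) set)" "(1, 0) \<in> (UNIV \<times> {0} :: ('k \<times> 'k) set)" "(1, 0) \<noteq> (0 :: 'k \<times> 'k)"
      by (simp_all add: zero_prod_def)
    then show "(UNIV :: ('k \<times> 'k) set) \<noteq> {0}" "(UNIV \<times> {0} :: ('k \<times> 'k) set) \<noteq> {0}"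
      by blast+
  qed
  then have "sp E p \<noteq> {0} \<longleftrightarrow> p \<in> insert (1, 2) ex_lines" for p
    using example_moduleD(3-5)[OF assms] by (cases "p \<in> ex_lines"; cases "p = (1, 2)") auto
  then show ?thesis
    unfolding supp_def by blast
qed

lemma card_supp_example:
  assumes "example_module E"
  shows "finite (supp E)" and "card (supp E) = 11"
  using supp_example[OF assms] by (auto simp: ex_lines_def)

lemma example_has_hole:
  fixes E :: "('k::field, 'k \<times> 'k) pmodule"
  assumes "example_module E"
  shows "support_has_hole E"
proof -
  \<comment> \<open>The four squares around the missing point \<open>(2, 1)\<close>; their boundary is the cycle around the hole.\<close>
  define c :: "point \<Rightarrow>\<^sub>0 'k" where
    "c = Poly_Mapping.single (1,0) 1 + Poly_Mapping.single (1,1) 1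
       + Poly_Mapping.single (2,0) 1 + Poly_Mapping.single (2,1) 1"
  have c: "Poly_Mapping.lookup c (i, j) = (if i \<in> {1, 2} \<and> j \<in> {0, 1} then 1 else 0)" for i j
    by (auto simp: c_def lookup_add lookup_single when_def)
  have "Poly_Mapping.lookup (boundary2 c) (p, q) = 0" if "(p, q) \<notin> cc_edges (supp E)" for p q
  proof -
    obtain i j where p: "p = (i, j)" by (cases p)
    show ?thesis
      using that unfolding lookup_boundary2 p
      by (auto simp: c cc_edges_def supp_example[OF assms] ex_lines_def)
  qed
  then have keys: "Poly_Mapping.keys (boundary2 c) \<subseteq> cc_edges (supp E)"
    unfolding subset_iff in_keys_iff by (metis surj_pair)
  then have "boundary2 c \<in> cycles1 (supp E)"
    using boundary1_boundary2 by (simp add: cycles1_def)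
  moreover have "boundary2 c \<notin> boundaries1 (supp E)"
  proof
    assume "boundary2 c \<in> boundaries1 (supp E)"
    then obtain d where d: "boundary2 c = boundary2 d" "Poly_Mapping.keys d \<subseteq> cc_squares (supp E)"
      by (auto simp: boundaries1_def)
    \<comment> \<open>These are the two squares at the edge from \<open>(1, 0)\<close> to
      \<open>(1, 1)\<close>. Each has a missing corner, so no boundary has a nonzero coefficient on
      this edge.\<close>
    have "(1, 0) \<notin> cc_squares (supp E)" "(0, 0) \<notin> cc_squares (supp E)"
      by (auto simp: cc_squares_def supp_example[OF assms] ex_lines_def)
    then have "Poly_Mapping.lookup d (1, 0) = 0" "Poly_Mapping.lookup d (0, 0) = 0"
      using d(2) unfolding subset_iff in_keys_iff by blast+
    then have "Poly_Mapping.lookup (boundary2 d) ((1,0), (1,1)) = 0"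
      by (simp add: lookup_boundary2 zero_prod_def)
    moreover have "Poly_Mapping.lookup (boundary2 c) ((1,0), (1,1)) = -1"
      by (simp add: lookup_boundary2 c zero_prod_def)
    ultimately show False
      using d(1) by simp
  qed
  ultimately show ?thesis
    by (auto simp: support_has_hole_iff)
qed

lemma example_indecomposable:
  fixes E :: "('k::field, 'k \<times> 'k) pmodule"
  assumes ex: "example_module E"
  shows "indecomposable E"
proof (rule indecomposableI)
  note ED = example_moduleD[OF ex]
  show "persistence_module E"
    by (rule ED(1))
  show "\<not> zero_module E"
  proof -
    have "(1, 2) \<in> supp E"
      using supp_example[OF ex] by simp
    then show ?thesis
      unfolding zero_module_def supp_def by blast
  qed
  fix e :: "point \<Rightarrow> 'k \<times> 'k \<Rightarrow> 'k \<times> 'k"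
  assume lin: "\<And>p. linear_between (scl E) (scl E) (sp E p) (sp E p) (e p)"
    and nat: "\<And>p q x. p \<le> q \<Longrightarrow> x \<in> sp E p \<Longrightarrow> e q (tr E p q x) = tr E p q (e p x)"
    and idem: "\<And>p x. x \<in> sp E p \<Longrightarrow> e p (e p x) = e p x"
  define c where "c p = fst (e p (1, 0))" for p
  have line: "e p (x, 0) = (x * c p, 0)" if p: "p \<in> ex_lines" for p x
  proof -
    have m: "(1, 0) \<in> sp E p"
      using ED(4)[OF p] by simp
    have "e p (1, 0) = (c p, 0)"
      using linear_betweenD(1)[OF lin m] ED(4)[OF p] by (auto simp: c_def)
    then have "e p (scale2 x (1, 0)) = scale2 x (c p, 0)"
      using linear_betweenD(3)[OF lin m, of x] ED(2) by simp
    then show ?thesis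
      by (simp add: scale2_Pair)
  qed
  have L: "(0,2) \<in> ex_lines" "(0,3) \<in> ex_lines" "(1,0) \<in> ex_lines" "(1,1) \<in> ex_lines" "(1,3) \<in> ex_lines"
    "(2,0) \<in> ex_lines" "(2,2) \<in> ex_lines" "(3,0) \<in> ex_lines" "(3,1) \<in> ex_lines" "(3,2) \<in> ex_lines"
    by (auto simp: ex_lines_def)
  have id_edge: "c p = c q" if "(p, q) \<in> {((1,0),(1,1)), ((0,2),(0,3)), ((0,3),(1,3)), ((1,0),(2,0)),
                ((2,2),(3,2)), ((3,0),(3,1)), ((3,1),(3,2))}" for p q
  proof -
    have pq: "p \<in> ex_lines" "q \<in> ex_lines" "p \<le> q"
      using that by (auto simp: ex_lines_def)
    have "e q (tr E p q (1, 0)) = tr E p q (e p (1, 0))"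
      using nat[OF pq(3)] ED(4)[OF pq(1)] by simp
    then show ?thesis
      using ED(10)[OF that] line[OF pq(1)] line[OF pq(2)] by simp
  qed
  define C where "C = c (1,1)"
  have e12: "e (1,2) (1, 0) = (C, 0)"
    using nat[of "(1,1)" "(1,2)" "(1,0)"] ED(4)[OF L(4)] ED(6)[of 1] ED(6)[of C] line[OF L(4), of 1]
    by (simp add: C_def)
  have e12': "e (1,2) (1, 1) = (c (0,2), c (0,2))"
    using nat[of "(0,2)" "(1,2)" "(1,0)"] ED(4)[OF L(1)] ED(7)[of 1] ED(7)[of "c (0,2)"] line[OF L(1), of 1]
    by simp
  have e12'': "e (1,2) (0, 1) = (c (0,2) - C, c (0,2))"
  proof -
    have "e (1,2) ((1, 0) + (0, 1)) = e (1,2) (1, 0) + e (1,2) (0, 1)"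
      by (rule linear_betweenD(2)[OF lin]) (simp_all add: ED(3))
    then have "(c (0,2), c (0,2)) = (C, 0) + e (1,2) (0, 1)"
      using e12 e12' by simp
    then show ?thesis
      by (cases "e (1,2) (0, 1)") simp
  qed
  \<comment> \<open>The vector \<open>(0, 1)\<close> spans the kernel of the map to
    \<open>(1, 3)\<close>, so the first coordinate of its value must vanish. This is where the third
    line enters.\<close>
  have c02: "c (0,2) = C"
    using nat[of "(1,2)" "(1,3)" "(0,1)"] ED(3) ED(8)[of 0 1] ED(8)[of "c (0,2) - C" "c (0,2)"] e12''
      line[OF L(5), of 0] by simp
  have c13: "c (1,3) = C"
    using nat[of "(1,2)" "(1,3)" "(1,0)"] ED(3) ED(8)[of 1 0] ED(8)[of C 0] e12
      line[OF L(5), of 1] by simp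
  have c22: "c (2,2) = C"
    using nat[of "(1,2)" "(2,2)" "(0,1)"] ED(3) ED(9)[of 0 1] ED(9)[of 0 C] e12'' c02
      line[OF L(7), of 1] by simp
  \<comment> \<open>The zero map from \<open>(2, 0)\<close> to \<open>(3, 0)\<close> carries no
    information; \<open>(3, 0)\<close> and \<open>(3, 1)\<close> are reached from
    \<open>(2, 2)\<close> through \<open>(3, 2)\<close>.\<close>
  have cC: "c p = C" if "p \<in> ex_lines" for p
    using that c02 c13 c22 id_edge[of "(1,0)" "(1,1)"] id_edge[of "(0,2)" "(0,3)"] id_edge[of "(1,0)" "(2,0)"]
      id_edge[of "(2,2)" "(3,2)"] id_edge[of "(3,0)" "(3,1)"] id_edge[of "(3,1)" "(3,2)"]
    by (auto simp: ex_lines_def C_def)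
  have eC: "e p x = scale2 C x" if x: "x \<in> sp E p" for p x
  proof -
    obtain y z where yz: "x = (y, z)" by (cases x)
    consider "p \<in> ex_lines" | "p = (1, 2)" | "p \<notin> insert (1, 2) ex_lines" by blast
    then show ?thesis
    proof cases
      case 1
      then show ?thesis
        using x line[OF 1] cC[OF 1] ED(4)[OF 1] yz by (simp add: scale2_Pair)
    next
      case 2
      have "e p (scale2 y (1, 0) + scale2 z (0, 1)) = scale2 y (e p (1, 0)) + scale2 z (e p (0, 1))"
        using linear_betweenD(2,3)[OF lin[of p]] 2 ED(2,3) by simp
      then show ?thesis
        using 2 e12 e12'' c02 yz by (simp add: scale2_Pair mult.commute)
    next
      case 3
      then show ?thesis
        using linear_betweenD(1)[OF lin x] x ED(5)[OF 3] by (simp add: zero_prod_def scale2_Pair)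
    qed
  qed
  have "C * C = C"
    using idem[of "(1,0)" "(1,1)"] eC[of _ "(1,1)"] ED(4)[OF L(4)] by (simp add: scale2_Pair)
  then have "C = 0 \<or> C = 1" by simp
  then show "(\<forall>p. \<forall>x \<in> sp E p. e p x = 0) \<or> (\<forall>p. \<forall>x \<in> sp E p. e p x = x)"
  proof
    assume "C = 0"
    then have "\<forall>p. \<forall>x \<in> sp E p. e p x = 0"
      using eC by (auto simp: scale2_Pair zero_prod_def)
    then show ?thesis ..
  next
    assume "C = 1"
    then have "\<forall>p. \<forall>x \<in> sp E p. e p x = x"
      using eC by (auto simp: scale2_Pair)
    then show ?thesis ..
  qed
qed

section \<open>Existence of the example\<close>

text \<open>These are the pairs of distinct points whose composite structure map is nonzero. For
  instance \<open>((1,0),(2,2))\<close> is absent, because the line \<open>(x, 0)\<close> at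
  \<open>(1, 2)\<close> goes to zero at \<open>(2, 2)\<close>.\<close>

definition ex_pairs :: "(point \<times> point) set" where
  "ex_pairs = {((1,0),(1,1)), ((1,0),(1,2)), ((1,0),(1,3)), ((1,0),(2,0)), ((1,1),(1,2)), ((1,1),(1,3)),
     ((0,2),(0,3)), ((0,2),(1,2)), ((0,2),(1,3)), ((0,2),(2,2)), ((0,2),(3,2)), ((0,3),(1,3)),
     ((1,2),(1,3)), ((1,2),(2,2)), ((1,2),(3,2)), ((2,2),(3,2)),
     ((3,0),(3,1)), ((3,0),(3,2)), ((3,1),(3,2))}"

definition ex_map :: "point \<Rightarrow> point \<Rightarrow> 'k::field \<times> 'k \<Rightarrow> 'k \<times> 'k" where
  "ex_map p q v = (if p = q then v
     else if (p, q) \<notin> ex_pairs then 0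
     else if (p, q) = ((0,2), (1,2)) then (fst v, fst v)
     else if p = (1,2) \<and> q \<in> {(2,2), (3,2)} then (snd v, 0)
     else (fst v, 0))"

definition ex_space :: "point \<Rightarrow> ('k::field \<times> 'k) set" where
  "ex_space p = (if p = (1, 2) then UNIV else if p \<in> ex_lines then UNIV \<times> {0} else {0})"

text \<open>A nonzero map has nonzero factors. Any \<open>q\<close> between \<open>p\<close> and
  \<open>r\<close> lies in the box from \<open>(0, 0)\<close> to \<open>(3, 3)\<close>, which leaves
  a finite check.\<close>

lemma ex_pairs_convex:
  assumes "(p, r) \<in> ex_pairs" and "p \<le> q" and "q \<le> r"
  shows "p = q \<or> q = r \<or> (p, q) \<in> ex_pairs \<and> (q, r) \<in> ex_pairs"
proof -
  have convex: "\<forall>(p, r) \<in> ex_pairs. \<forall>i \<in> {0, 1, 2, 3}. \<forall>j \<in> {0, 1, 2, 3}. p \<le> (i, j) \<longrightarrow> (i, j) \<le> r \<longrightarrow>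
      p = (i, j) \<or> (i, j) = r \<or> (p, i, j) \<in> ex_pairs \<and> ((i, j), r) \<in> ex_pairs"
    by code_simp
  obtain i j where q: "q = (i, j)" by (cases q)
  have "\<forall>(p, r) \<in> ex_pairs. (0, 0) \<le> p \<and> r \<le> (3, 3)"
    by code_simp
  then have "(0, 0) \<le> q" "q \<le> (3, 3)"
    using assms by (auto dest: order.trans)
  then have "i \<in> {0, 1, 2, 3}" "j \<in> {0, 1, 2, 3}"
    by (auto simp: q)
  then show ?thesis
    using convex assms q by fast
qed

text \<open>Covers all chains of two composable nonzero maps, including the four whose composite is
  zero because they enter \<open>(1, 2)\<close> along \<open>(x, 0)\<close> and leave it by the
  second coordinate.\<close>

definition ex_triples :: "(point \<times> point \<times> point) set" where
  "ex_triples =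
     {((1,0),(1,1),(1,2)), ((1,0),(1,1),(1,3)), ((1,0),(1,2),(1,3)), ((1,0),(1,2),(2,2)), ((1,0),(1,2),(3,2)),
      ((1,1),(1,2),(1,3)), ((1,1),(1,2),(2,2)), ((1,1),(1,2),(3,2)), ((0,2),(0,3),(1,3)), ((0,2),(1,2),(1,3)),
      ((0,2),(1,2),(2,2)), ((0,2),(1,2),(3,2)), ((0,2),(2,2),(3,2)), ((1,2),(2,2),(3,2)), ((3,0),(3,1),(3,2))}"

lemma ex_map_compose:
  fixes v :: "'a::field \<times> 'a"
  assumes "p \<le> q" and "q \<le> r" and v: "v \<in> ex_space p"
  shows "ex_map q r (ex_map p q v) = ex_map p r v"
proof -
  have zero: "ex_map q r 0 = 0"
    by (simp add: ex_map_def zero_prod_def)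
  have pq: "p = q \<or> q = r \<or> p \<noteq> r"
    using assms(1,2) order.antisym by blast
  consider "p = q" | "q = r" | "p \<noteq> q" "q \<noteq> r" "(p, q) \<in> ex_pairs" "(q, r) \<in> ex_pairs"
    | "p \<noteq> q" "q \<noteq> r" "(p, r) \<notin> ex_pairs" "(p, q) \<notin> ex_pairs \<or> (q, r) \<notin> ex_pairs"
    using ex_pairs_convex[of p r q] assms by blast
  then show ?thesis
  proof cases
    case 3
    have "\<forall>(p, q) \<in> ex_pairs. \<forall>(q', r) \<in> ex_pairs. q = q' \<longrightarrow> (p, q, r) \<in> ex_triples"
      by code_simp
    with 3(3,4) have "(p, q, r) \<in> ex_triples"
      by fast
    with v show ?thesis
      unfolding ex_triples_def insert_iff empty_iff prod.inject
      by (elim disjE conjE FalseE; simp add: ex_map_def ex_pairs_def ex_space_def ex_lines_def zero_prod_def mem_Times_iff)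
  next
    case 4
    have no_pair: "ex_map s t w = 0" if "s \<noteq> t" "(s, t) \<notin> ex_pairs" for s t and w :: "'a \<times> 'a"
      using that by (simp add: ex_map_def)
    show ?thesis
      using 4(4) no_pair[of p q v] no_pair[of q r "ex_map p q v"] no_pair[of p r v] 4(1-3) pq zero
      by auto
  qed (simp_all add: ex_map_def)
qed

lemma linear_between_ex_map:
  "linear_between scale2 scale2 (ex_space p) (ex_space q) (ex_map p q :: 'k::field \<times> 'k \<Rightarrow> _)"
proof -
  have "ex_map p q v \<in> ex_space q" if "v \<in> ex_space p" for v :: "'k \<times> 'k"
  proof (cases "(p, q) \<in> ex_pairs")
    case True
    then have "q = (1, 2) \<or> q \<in> ex_lines \<and> q \<noteq> (1, 2) \<and> (p, q) \<noteq> ((0,2), (1,2)) \<and> p \<noteq> q"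
      by (auto simp: ex_pairs_def ex_lines_def)
    with True show ?thesis
      by (auto simp: ex_map_def ex_space_def)
  next
    case False
    then show ?thesis
      using that by (auto simp: ex_map_def ex_space_def zero_prod_def)
  qed
  then show ?thesis
    by (auto simp: linear_between_def ex_map_def scale2_Pair zero_prod_def)
qed

lemma fin_dim_ex_space: "fin_dim_subspace (scale2 :: 'k::field \<Rightarrow> _) (ex_space p)"
proof -
  interpret vector_space "scale2 :: 'k \<Rightarrow> _"
    by (rule vector_space_scale2)
  have gen: "(x, y) = scale2 x (1, 0) + scale2 y (0, 1)" for x y :: 'k
    by (simp add: scale2_Pair)
  have sub: "subspace (ex_space p :: ('k \<times> 'k) set)"
    by (rule subspaceI) (auto simp: ex_space_def zero_prod_def scale2_Pair)
  have "(x, y) \<in> span {(1, 0), (0, 1)}" for x y :: 'k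
    unfolding gen[of x y] by (intro span_add span_scale span_base) simp_all
  then have "span {(1, 0), (0, 1)} = (UNIV :: ('k \<times> 'k) set)"
    by (intro set_eqI) (simp add: split_paired_all)
  then have "fin_dim_subspace (scale2 :: 'k \<Rightarrow> _) (UNIV :: ('k \<times> 'k) set)"
    unfolding fin_dim_subspace_def by (intro conjI subspace_UNIV exI[of _ "{(1, 0), (0, 1)}"]) simp_all
  then show ?thesis
    by (rule ambient_space.fin_dim_subspace_subset[OF ambient_space.intro[OF vector_space_scale2] _ sub]) simp
qed

lemma example_module_exists: "\<exists>E :: ('k::field, 'k \<times> 'k) pmodule. example_module E"
proof
  let ?E = "\<lparr>scl = scale2, sp = ex_space, tr = ex_map\<rparr> :: ('k, 'k \<times> 'k) pmodule"
  have "persistence_module ?E"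
    unfolding persistence_module_def
  proof (intro conjI allI impI ballI)
    fix p q r :: point and x
    show "vector_space (scl ?E)"
      by (simp add: vector_space_scale2)
    show "fin_dim_subspace (scl ?E) (sp ?E p)"
      by (simp add: fin_dim_ex_space)
    show "linear_between (scl ?E) (scl ?E) (sp ?E p) (sp ?E q) (tr ?E p q)"
      by (simp add: linear_between_ex_map)
    show "tr ?E p p x = x"
      by (simp add: ex_map_def)
    assume "p \<le> q" "q \<le> r" "x \<in> sp ?E p"
    then show "tr ?E q r (tr ?E p q x) = tr ?E p r x"
      using ex_map_compose by simp
  qed
  then show "example_module ?E"
    by (auto simp: example_module_def Let_def ex_space_def ex_lines_def ex_map_def ex_pairs_def zero_prod_def)
qed

text \<open>As \<open>example_module\<close> is a property and not a construction, the second clause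
  keeps the third from being vacuous. Finiteness is demanded in the first because
  \<open>card\<close> of an infinite set is 0.\<close>

theorem theorem5p4:
  shows
    "(\<forall>M :: ('k::field, 'v::ab_group_add) pmodule.
        indecomposable M \<and> support_has_hole M \<and> finite (supp M) \<longrightarrow> 11 \<le> card (supp M))
     \<and> (\<exists>E :: ('k, 'k \<times> 'k) pmodule. example_module E)
     \<and> (\<forall>E :: ('k, 'k \<times> 'k) pmodule. example_module E \<longrightarrow>
          indecomposable E \<and> support_has_hole E \<and> finite (supp E) \<and> card (supp E) = 11)"
  using indecomposable_hole_card example_module_exists example_indecomposable example_has_hole
    card_supp_example
  by blast

end
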